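(* Let $X_d$ denote either $C(\mathbb{R}^d)$ or $\mathcal{D}(\mathbb{R}^d)'$. Let $h_1,\dots,h_t\in\mathbb{R}^d$ be such that the subgroup $h_1\mathbb{Z}+\dots+h_t\mathbb{Z}$ is dense in $\mathbb{R}^d$, let $f\in X_d$, and suppose there are natural numbers $m_1,\dots,m_t$ such that for every $k\in\{1,\dots,t\}$, $\Delta_{h_k}^{m_k}f$ is (in distributional sense) a continuous exponential polynomial. Then $f$ is (in distributional sense) a continuous exponential polynomial.
   Context: $C(\mathbb{R}^d)$ is the space of continuous complex valued functions on $\mathbb{R}^d$ and $\mathcal{D}(\mathbb{R}^d)'$ the space of complex valued Schwartz distributions. For a function $f$: $(\tau_yf)(x)=f(x+y)$ and $\Delta_h^mf=\sum_{k=0}^m\binom{m}{k}(-1)^{m-k}\tau_{kh}f$. For a distribution $f$ and test function $\varphi$: $(\Delta_h^mf)\{\varphi\}=f\{\Delta_{-h}^m\varphi\}$. A continuous exponential polynomial on $\mathbb{R}^d$ is a function of the form $x\mapsto\sum_{j=1}^r p_j(x)e^{\langle\lambda_j,x\rangle}$ with polynomials $p_j$ and $\lambda_j\in\mathbb{C}^d$; a distribution is a continuous exponential polynomial in distributional sense if it is the distribution $\varphi\mapsto\int e\varphi$ induced by such a function $e$. *)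

theory Defs
  imports "HOL-Analysis.Analysis"
begin

definition fdiff :: "(real^'n) \<Rightarrow> nat \<Rightarrow> ((real^'n) \<Rightarrow> complex) \<Rightarrow> (real^'n) \<Rightarrow> complex" where
  "fdiff h m f x = (\<Sum>k\<le>m. of_nat (m choose k) * (-1) ^ (m - k) * f (x + real k *\<^sub>R h))"

definition monomial_fn :: "('n \<Rightarrow> nat) \<Rightarrow> (real^'n) \<Rightarrow> complex" where
  "monomial_fn \<alpha> x = (\<Prod>i\<in>UNIV. complex_of_real (x $ i) ^ \<alpha> i)"

definition cinner :: "(complex^'n) \<Rightarrow> (real^'n) \<Rightarrow> complex" where
  "cinner l x = (\<Sum>i\<in>UNIV. l $ i * complex_of_real (x $ i))"

definition poly_fn :: "((real^'n) \<Rightarrow> complex) \<Rightarrow> bool" where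
  "poly_fn p \<longleftrightarrow> (\<exists>A c. finite A \<and> (\<forall>x. p x = (\<Sum>\<alpha>\<in>A. c \<alpha> * monomial_fn \<alpha> x)))"

definition expo_poly :: "((real^'n) \<Rightarrow> complex) \<Rightarrow> bool" where
  "expo_poly e \<longleftrightarrow> (\<exists>(r::nat) p lam. (\<forall>j<r. poly_fn (p j)) \<and>
      (\<forall>x. e x = (\<Sum>j<r. p j x * exp (cinner (lam j) x))))"

definition pderiv_fn :: "'n \<Rightarrow> ((real^'n) \<Rightarrow> complex) \<Rightarrow> (real^'n) \<Rightarrow> complex" where
  "pderiv_fn i f x = vector_derivative (\<lambda>t. f (x + t *\<^sub>R axis i 1)) (at 0)"

fun pderivs :: "'n list \<Rightarrow> ((real^'n) \<Rightarrow> complex) \<Rightarrow> (real^'n) \<Rightarrow> complex" where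
  "pderivs [] f = f"
| "pderivs (i # is) f = pderiv_fn i (pderivs is f)"

definition smooth_fn :: "((real^'n) \<Rightarrow> complex) \<Rightarrow> bool" where
  "smooth_fn f \<longleftrightarrow> (\<forall>is. continuous_on UNIV (pderivs is f) \<and>
      (\<forall>i x. (\<lambda>t. pderivs is f (x + t *\<^sub>R axis i 1)) differentiable (at 0)))"

definition test_fn :: "((real^'n) \<Rightarrow> complex) \<Rightarrow> bool" where
  "test_fn \<phi> \<longleftrightarrow> smooth_fn \<phi> \<and> (\<exists>K. compact K \<and> (\<forall>x. x \<notin> K \<longrightarrow> \<phi> x = 0))"

text \<open>Schwartz distributions: linear functionals on test functions which are (sequentially)
  continuous w.r.t. convergence in D(R^d).  Values on non-test functions are irrelevant.\<close>
definition distribution :: "(((real^'n) \<Rightarrow> complex) \<Rightarrow> complex) \<Rightarrow> bool" where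
  "distribution T \<longleftrightarrow>
     (\<forall>\<phi> \<psi> a b. test_fn \<phi> \<longrightarrow> test_fn \<psi> \<longrightarrow>
         T (\<lambda>x. a * \<phi> x + b * \<psi> x) = a * T \<phi> + b * T \<psi>) \<and>
     (\<forall>\<phi> :: nat \<Rightarrow> (real^'n) \<Rightarrow> complex. \<forall>K.
         compact K \<and> (\<forall>j. test_fn (\<phi> j) \<and> (\<forall>x. x \<notin> K \<longrightarrow> \<phi> j x = 0)) \<and>
         (\<forall>is. \<forall>\<epsilon>>0. eventually (\<lambda>j. \<forall>x. norm (pderivs is (\<phi> j) x) < \<epsilon>) sequentially)
         \<longrightarrow> (\<lambda>j. T (\<phi> j)) \<longlonglongrightarrow> 0)"

definition dist_fdiff :: "(real^'n) \<Rightarrow> nat \<Rightarrow> (((real^'n) \<Rightarrow> complex) \<Rightarrow> complex) \<Rightarrow> ((real^'n) \<Rightarrow> complex) \<Rightarrow> complex" where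
  "dist_fdiff h m T \<phi> = T (fdiff (- h) m \<phi>)"

definition dist_exp_poly :: "(((real^'n) \<Rightarrow> complex) \<Rightarrow> complex) \<Rightarrow> bool" where
  "dist_exp_poly T \<longleftrightarrow> (\<exists>e. expo_poly e \<and>
     (\<forall>\<phi>. test_fn \<phi> \<longrightarrow> T \<phi> = integral\<^sup>L lborel (\<lambda>x. e x * \<phi> x)))"

definition dense_subgroup :: "nat \<Rightarrow> (nat \<Rightarrow> (real^'n)) \<Rightarrow> bool" where
  "dense_subgroup t h \<longleftrightarrow>
     closure {(\<Sum>k\<in>{1..t}. real_of_int (n k) *\<^sub>R h k) | n :: nat \<Rightarrow> int. True} = UNIV"

end

theory Submission
  imports Defs "HOL-Library.Function_Algebras" "HOL-Computational_Algebra.Fundamental_Theorem_Algebra"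
begin

text \<open>
  An exponential polynomial has finite-dimensional span of translates, so the hypotheses force the
  translates of \<open>f\<close> by the group generated by the \<open>h\<^sub>k\<close> to span a finite-dimensional space; by
  density of the group and continuity the same holds for all translates. A finite-dimensional space
  of functions has a Lagrange basis, which makes it closed under pointwise limits. On the real line
  this closedness, applied to the averages of a continuous function with finite-dimensional orbit,
  shows that the function is differentiable with derivative in the same space; hence it solves a
  linear differential equation with constant coefficients and is an exponential polynomial. Splitting
  off one coordinate after the other gives the result for continuous functions on \<open>\<real>\<^sup>d\<close>.

  For a distribution \<open>T\<close> the functions \<open>f\<^sub>\<phi> y = T (\<phi> (\<cdot> - y))\<close> are continuous with finite-dimensional orbit,
  hence exponential polynomials, and they all lie in one finite-dimensional space. Evaluating \<open>T\<close> on
  the convolution of \<open>\<phi>\<close> and \<open>\<psi>\<close> yields \<open>\<integral> f\<^sub>\<phi> \<psi> = \<integral> f\<^sub>\<psi> \<phi>\<close>. Expanding the functional \<open>\<psi> \<mapsto> \<integral> f\<^sub>\<phi> \<psi>\<close>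
  in a Lagrange basis with nodes \<open>\<psi>\<^sub>i\<close> then exhibits \<open>T \<phi> = f\<^sub>\<phi> 0\<close> as the integral of \<open>\<phi>\<close> against a
  linear combination of the \<open>f\<^bsub>\<psi>\<^sub>i\<^esub>\<close>.
\<close>

section \<open>Finite-dimensional spaces of functions and orbits\<close>

text \<open>A named scalar multiplication lets the locale \<open>vector_space\<close> be interpreted
  over the complex field with pointwise addition. The domain stays arbitrary because points, reals
  and test functions all occur as arguments.\<close>

definition cscale :: "complex \<Rightarrow> ('x \<Rightarrow> complex) \<Rightarrow> 'x \<Rightarrow> complex" where
  "cscale c f = (\<lambda>x. c * f x)"

lemma cscale_apply: "cscale c f x = c * f x"
  by (simp add: cscale_def)

interpretation fs: vector_space "cscale :: complex \<Rightarrow> ('x \<Rightarrow> complex) \<Rightarrow> 'x \<Rightarrow> complex"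
  by unfold_locales (auto simp: cscale_apply fun_eq_iff algebra_simps)

lemma sum_fun_apply: "(\<Sum>i\<in>I. f i) x = (\<Sum>i\<in>I. f i x :: complex)"
  by (induction I rule: infinite_finite_induct) auto

lemma span_lincomb:
  assumes "\<And>i. i \<in> I \<Longrightarrow> g i \<in> fs.span B"
  shows "(\<lambda>x. \<Sum>i\<in>I. c i * g i x) \<in> fs.span B"
proof -
  have "(\<Sum>i\<in>I. cscale (c i) (g i)) \<in> fs.span B"
    using assms by (intro fs.span_sum fs.span_scale)
  moreover have "(\<Sum>i\<in>I. cscale (c i) (g i)) = (\<lambda>x. \<Sum>i\<in>I. c i * g i x)"
    by (auto simp: sum_fun_apply cscale_apply)
  ultimately show ?thesis by simp
qed

lemma span_finite_lincomb:
  assumes "finite B" "g \<in> fs.span B"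
  obtains c where "g = (\<lambda>x. \<Sum>b\<in>B. c b * b x)"
proof -
  obtain c where "g = (\<Sum>b\<in>B. cscale (c b) b)"
    using assms by (auto simp: fs.span_finite)
  then have "g = (\<lambda>x. \<Sum>b\<in>B. c b * b x)"
    by (auto simp: sum_fun_apply cscale_apply)
  then show ?thesis using that by blast
qed

text \<open>Substitution is linear in \<open>g\<close>. It serves with \<open>k\<close> a
  translation, a parametrised line, or the map from a vector to the translate of a fixed test
  function.\<close>

lemma span_pullback:
  assumes "g \<in> fs.span B"
  shows "(\<lambda>x. g (k x)) \<in> fs.span ((\<lambda>b x. b (k x)) ` B)"
  using assms
proof (induction rule: fs.span_induct_alt)
  case base
  show ?case using fs.span_zero by (simp add: zero_fun_def)
next
  case (step c u v)
  have "cscale c (\<lambda>x. u (k x)) + (\<lambda>x. v (k x)) \<in> fs.span ((\<lambda>b x. b (k x)) ` B)"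
    using step by (intro fs.span_add fs.span_scale) (auto intro: fs.span_base)
  moreover have "cscale c (\<lambda>x. u (k x)) + (\<lambda>x. v (k x)) = (\<lambda>x. (cscale c u + v) (k x))"
    by (auto simp: cscale_apply)
  ultimately show ?case by simp
qed

text \<open>Nodes are found one generator at a time. The new generator \<open>u\<close> is replaced
  by its interpolation error \<open>v\<close>, which vanishes at all old nodes; if \<open>v\<close>
  is not zero, a point where it does not vanish becomes a new node. Since the coefficients of the
  resulting expansion are point values, limits and identities can be checked on finitely many
  evaluations.\<close>

lemma lagrange_span:
  fixes B :: "('x \<Rightarrow> complex) set"
  assumes "finite B"
  shows "\<exists>P G. finite P \<and> (\<forall>p\<in>P. G p \<in> fs.span B) \<and> (\<forall>p\<in>P. \<forall>q\<in>P. G p q = (if p = q then 1 else 0)) \<and>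
    (\<forall>g\<in>fs.span B. g = (\<lambda>x. \<Sum>p\<in>P. g p * G p x))"
  using assms
proof (induction B)
  case empty
  show ?case by (rule exI[of _ "{}"]) (auto simp: zero_fun_def)
next
  case (insert u B)
  obtain P G where P: "finite P" and PG: "\<forall>p\<in>P. G p \<in> fs.span B"
      "\<forall>p\<in>P. \<forall>q\<in>P. G p q = (if p = q then 1 else 0)"
      "\<forall>g\<in>fs.span B. g = (\<lambda>x. \<Sum>p\<in>P. g p * G p x)"
    using insert.IH by (elim exE conjE)
  note G = bspec[OF PG(1)] and K = bspec[OF bspec[OF PG(2)]] and L = bspec[OF PG(3)]
  define s where "s = (\<lambda>x. \<Sum>p\<in>P. u p * G p x)"
  define v where "v = u - s"
  have s: "s \<in> fs.span B" unfolding s_def using G by (rule span_lincomb)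
  have sq: "s q = u q" if "q \<in> P" for q
    using that P by (simp add: s_def K if_distrib sum.delta' cong: if_cong)
  then have v0: "v q = 0" if "q \<in> P" for q using that by (simp add: v_def)
  show ?case
  proof (cases "v = 0")
    case True
    then have "u \<in> fs.span B" using s by (simp add: v_def)
    then have "fs.span (insert u B) = fs.span B" by (rule fs.span_redundant)
    then show ?thesis using P PG by (intro exI[of _ P] exI[of _ G] conjI) simp_all
  next
    case False
    then obtain z where z: "v z \<noteq> 0" by (auto simp: fun_eq_iff)
    then have zP: "z \<notin> P" using v0 by auto
    define w where "w = (\<lambda>x. v x / v z)"
    have sub: "fs.span B \<subseteq> fs.span (insert u B)" by (rule fs.span_mono) auto
    have vs: "v \<in> fs.span (insert u B)"
      unfolding v_def using s sub by (intro fs.span_diff) (auto intro: fs.span_base)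
    have ws: "w \<in> fs.span (insert u B)"
    proof -
      have "cscale (1 / v z) v = w" by (auto simp: w_def cscale_apply)
      then show ?thesis using fs.span_scale[OF vs, of "1 / v z"] by simp
    qed
    \<comment> \<open>\<open>w\<close> vanishes at the old nodes and is 1 at \<open>z\<close>, so
      the correction makes the old basis functions vanish at \<open>z\<close> without changing their
      values on \<open>P\<close>.\<close>
    define H where "H = (\<lambda>p. if p = z then w else (\<lambda>x. G p x - G p z * w x))"
    have w0: "w q = 0" if "q \<in> P" for q using that v0 by (simp add: w_def)
    have w1: "w z = 1" using z by (simp add: w_def)
    have Hs: "H p \<in> fs.span (insert u B)" if "p \<in> insert z P" for p
    proof (cases "p = z")
      case True
      then show ?thesis using ws by (simp add: H_def)
    next
      case False
      then have "G p - cscale (G p z) w \<in> fs.span (insert u B)"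
        using that G sub ws by (intro fs.span_diff fs.span_scale) auto
      moreover have "G p - cscale (G p z) w = H p" using False by (auto simp: H_def cscale_apply)
      ultimately show ?thesis by simp
    qed
    have HK: "H p q = (if p = q then 1 else 0)" if "p \<in> insert z P" "q \<in> insert z P" for p q
      using that zP w0 w1 K by (auto simp: H_def)
    have HL: "g = (\<lambda>x. \<Sum>p\<in>insert z P. g p * H p x)" if g: "g \<in> fs.span (insert u B)" for g
    proof -
      obtain c where c: "g - cscale c u \<in> fs.span B"
        using g unfolding fs.span_breakdown_eq by blast
      \<comment> \<open>Since \<open>u\<close> and \<open>v\<close> differ by a member of
        \<open>fs.span B\<close>, removing \<open>c\<close> times \<open>v\<close> also leaves a
        member of the old span, and one that agrees with \<open>g\<close> on
        \<open>P\<close>.\<close>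
      define k where "k = g - cscale c v"
      have "k = (g - cscale c u) + cscale c s"
        by (auto simp: k_def v_def cscale_apply fun_eq_iff algebra_simps)
      then have k: "k \<in> fs.span B" using c s by (simp add: fs.span_add fs.span_scale)
      have gk: "g x = k x + c * v x" for x by (simp add: k_def cscale_apply)
      have kg: "k q = g q" if "q \<in> P" for q using gk v0 that by simp
      have kx: "k x = (\<Sum>p\<in>P. g p * G p x)" for x
      proof -
        have "k x = (\<Sum>p\<in>P. k p * G p x)" using L[OF k] by (rule fun_cong)
        then show ?thesis using kg by simp
      qed
      have "g x = (\<Sum>p\<in>insert z P. g p * H p x)" for x
      proof -
        have "(\<Sum>p\<in>insert z P. g p * H p x) = g z * w x + (\<Sum>p\<in>P. g p * (G p x - G p z * w x))"
          using zP P by (simp add: H_def) (auto intro!: sum.cong)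
        also have "\<dots> = g z * w x + k x - k z * w x"
          by (simp add: kx right_diff_distrib sum_subtractf sum_distrib_right mult.assoc)
        also have "\<dots> = k x + c * v z * w x" using gk[of z] by (simp add: algebra_simps)
        also have "\<dots> = g x" using gk[of x] z by (simp add: w_def)
        finally show ?thesis by simp
      qed
      then show ?thesis by (rule ext)
    qed
    show ?thesis
      using P Hs HK by (intro exI[of _ "insert z P"] exI[of _ H] conjI ballI HL) auto
  qed
qed

text \<open>A maximal independent subset of \<open>V\<close> is finite because it lies in the span
  of the finite set \<open>B\<close>. The point is that the basis functions belong to
  \<open>V\<close> itself: they inherit every property that cuts out \<open>V\<close>, and
  \<open>V\<close> becomes closed under pointwise limits.\<close>

lemma lagrange_subspace:
  fixes V :: "('x \<Rightarrow> complex) set"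
  assumes "finite B" "V \<subseteq> fs.span B" "fs.subspace V"
  obtains P G where "finite P" "\<And>p. p \<in> P \<Longrightarrow> G p \<in> V"
    "\<And>g x. g \<in> V \<Longrightarrow> g x = (\<Sum>p\<in>P. g p * G p x)"
proof -
  obtain C where C: "C \<subseteq> V" "fs.independent C" "V \<subseteq> fs.span C"
    using fs.maximal_independent_subset by blast
  have fin: "finite C" using fs.independent_span_bound[OF assms(1) C(2)] C(1) assms(2) by blast
  have eq: "fs.span C = V" using C assms(3) fs.span_minimal by blast
  obtain P G where P: "finite P" "\<forall>p\<in>P. G p \<in> V"
      and L: "\<forall>g\<in>V. g = (\<lambda>x. \<Sum>p\<in>P. g p * G p x)"
    using lagrange_span[OF fin] unfolding eq by (elim exE conjE)
  show ?thesis
    using P by (intro that[of P G] fun_cong[OF bspec[OF L]]) auto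
qed

section \<open>Finite-dimensional orbits under an abstract action\<close>

definition fin_orbit :: "('g \<Rightarrow> 'x \<Rightarrow> 'x) \<Rightarrow> 'g set \<Rightarrow> ('x \<Rightarrow> complex) \<Rightarrow> bool" where
  "fin_orbit act S F \<longleftrightarrow> (\<exists>B. finite B \<and> (\<forall>y\<in>S. (\<lambda>x. F (act y x)) \<in> fs.span B))"

text \<open>Modulo \<open>fs.span W\<close> the sequence satisfies a linear recurrence whose outer
  coefficients are nonzero. It can be solved for its last and for its first term, so a window of
  \<open>m + 1\<close> consecutive members of the span moves one step in either direction.\<close>

lemma two_sided_recurrence_span:
  fixes a :: "int \<Rightarrow> 'x \<Rightarrow> complex" and c :: "nat \<Rightarrow> complex"
  assumes c: "c 0 \<noteq> 0" "c m \<noteq> 0"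
    and init: "\<And>i. i \<le> m \<Longrightarrow> a (int i) \<in> fs.span W"
    and rec: "\<And>n. (\<lambda>x. \<Sum>j\<le>m. c j * a (n + int j) x) \<in> fs.span W"
  shows "a n \<in> fs.span W"
proof -
  have step: "a (n + int k) \<in> fs.span W"
    if "k \<le> m" "c k \<noteq> 0" "\<And>j. j \<le> m \<Longrightarrow> j \<noteq> k \<Longrightarrow> a (n + int j) \<in> fs.span W" for n k
  proof -
    let ?R = "\<lambda>x. \<Sum>j\<le>m. c j * a (n + int j) x"
    let ?S = "\<lambda>x. \<Sum>j\<in>{..m} - {k}. c j * a (n + int j) x"
    have "?S \<in> fs.span W" using that by (intro span_lincomb) auto
    then have "cscale (1 / c k) (?R - ?S) \<in> fs.span W" using rec by (intro fs.span_scale fs.span_diff)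
    moreover have "cscale (1 / c k) (?R - ?S) = a (n + int k)"
      using that(1,2) by (auto simp: cscale_apply fun_eq_iff sum.remove[of "{..m}" k])
    ultimately show ?thesis by simp
  qed
  have "\<forall>i\<le>m. a (n + int i) \<in> fs.span W"
  proof (induction n rule: int_induct[where k = 0])
    case base
    show ?case using init by simp
  next
    case (step1 n)
    have w: "a (n + 1 + int j) \<in> fs.span W" if "j < m" for j
      using step1(2)[rule_format, of "Suc j"] that by (simp add: add_ac)
    have "a (n + 1 + int m) \<in> fs.span W" using c by (intro step[of m]) (auto intro: w)
    with w show ?case by (metis le_neq_implies_less)
  next
    case (step2 n)
    have w: "a (n - 1 + int j) \<in> fs.span W" if "0 < j" "j \<le> m" for j
      using step2(2)[rule_format, of "j - 1"] that by (simp add: add_ac of_nat_diff algebra_simps)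
    have "a (n - 1 + int 0) \<in> fs.span W" using c by (intro step[of 0]) (auto intro: w)
    with w show ?case by (metis neq0_conv)
  qed
  then show ?thesis by (metis add.right_neutral of_nat_0 zero_le)
qed

text \<open>For fixed \<open>y\<close>, the translates of \<open>F\<close> along multiples of
  \<open>h\<close> satisfy the binomial recurrence with translates of \<open>E\<close> on the
  right-hand side; its outer coefficients are (-1)^m and 1.\<close>

lemma fin_orbit_extend:
  fixes act :: "'g::real_vector \<Rightarrow> 'x \<Rightarrow> 'x"
  assumes act: "\<And>y z x. act (y + z) x = act y (act z x)"
    and F: "fin_orbit act S F" and E: "fin_orbit act UNIV E"
    and diff: "\<And>x. E x = (\<Sum>j\<le>m. of_nat (m choose j) * (-1) ^ (m - j) * F (act (real j *\<^sub>R h) x))"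
  shows "fin_orbit act {y + real_of_int n *\<^sub>R h | y n. y \<in> S} F"
proof -
  obtain B where B: "finite B" "\<And>y. y \<in> S \<Longrightarrow> (\<lambda>x. F (act y x)) \<in> fs.span B"
    using F by (auto simp: fin_orbit_def)
  obtain C where C: "finite C" "\<And>y. (\<lambda>x. E (act y x)) \<in> fs.span C"
    using E by (auto simp: fin_orbit_def)
  \<comment> \<open>\<open>W\<close> must not depend on \<open>y\<close> or \<open>n\<close>: it
    holds a translated copy of \<open>B\<close> for each initial term and \<open>C\<close> for the
    right-hand sides.\<close>
  define W where "W = (\<Union>i\<in>{..m}. (\<lambda>b x. b (act (real i *\<^sub>R h) x)) ` B) \<union> C"
  have "(\<lambda>x. F (act (y + real_of_int n *\<^sub>R h) x)) \<in> fs.span W" if y: "y \<in> S" for y n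
  proof (rule two_sided_recurrence_span[where m = m and c = "\<lambda>j. of_nat (m choose j) * (-1) ^ (m - j)"
        and a = "\<lambda>n x. F (act (y + real_of_int n *\<^sub>R h) x)"])
    fix i assume i: "i \<le> m"
    have "(\<lambda>x. F (act y (act (real i *\<^sub>R h) x))) \<in> fs.span ((\<lambda>b x. b (act (real i *\<^sub>R h) x)) ` B)"
      using span_pullback[OF B(2)[OF y]] .
    moreover have "fs.span ((\<lambda>b x. b (act (real i *\<^sub>R h) x)) ` B) \<subseteq> fs.span W"
      using i unfolding W_def by (intro fs.span_mono) auto
    ultimately show "(\<lambda>x. F (act (y + real_of_int (int i) *\<^sub>R h) x)) \<in> fs.span W"
      by (auto simp: act)
  next
    fix n :: int
    have "act (y + real_of_int (n + int j) *\<^sub>R h) x = act (real j *\<^sub>R h) (act (y + real_of_int n *\<^sub>R h) x)" for j x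
      by (simp add: act[symmetric] algebra_simps)
    then have "(\<lambda>x. \<Sum>j\<le>m. of_nat (m choose j) * (-1) ^ (m - j) * F (act (y + real_of_int (n + int j) *\<^sub>R h) x))
       = (\<lambda>x. E (act (y + real_of_int n *\<^sub>R h) x))"
      by (simp add: diff)
    moreover have "fs.span C \<subseteq> fs.span W" unfolding W_def by (intro fs.span_mono) auto
    ultimately show "(\<lambda>x. \<Sum>j\<le>m. of_nat (m choose j) * (-1) ^ (m - j) * F (act (y + real_of_int (n + int j) *\<^sub>R h) x)) \<in> fs.span W"
      using C(2) by auto
  qed auto
  moreover have "finite W" using B C by (auto simp: W_def)
  ultimately show ?thesis unfolding fin_orbit_def by blast
qed

text \<open>At each point \<open>x\<close>, the Lagrange expansion of the translate by
  \<open>y\<close> has both sides continuous in \<open>y\<close>, so it holds on a closed set of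
  \<open>y\<close>. This set contains \<open>S\<close>, hence is everything.\<close>

lemma fin_orbit_dense:
  fixes act :: "'g::topological_space \<Rightarrow> 'x \<Rightarrow> 'x"
  assumes F: "fin_orbit act S F" and S: "closure S = UNIV"
    and cont: "\<And>x. continuous_on UNIV (\<lambda>y. F (act y x))"
  shows "fin_orbit act UNIV F"
proof -
  obtain B where B: "finite B" "\<And>y. y \<in> S \<Longrightarrow> (\<lambda>x. F (act y x)) \<in> fs.span B"
    using F by (auto simp: fin_orbit_def)
  obtain P G where P: "finite P" "\<And>p. p \<in> P \<Longrightarrow> G p \<in> fs.span B"
    and L: "\<And>g x. g \<in> fs.span B \<Longrightarrow> g x = (\<Sum>p\<in>P. g p * G p x)"
    using lagrange_subspace[OF B(1) order_refl] fs.subspace_span by blast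
  have eq: "F (act y x) = (\<Sum>p\<in>P. F (act y p) * G p x)" for x y
  proof -
    have "closed {y. F (act y x) = (\<Sum>p\<in>P. F (act y p) * G p x)}"
      using cont by (intro closed_Collect_eq continuous_intros)
    moreover have "S \<subseteq> {y. F (act y x) = (\<Sum>p\<in>P. F (act y p) * G p x)}"
      using L[OF B(2)] by blast
    ultimately have "closure S \<subseteq> {y. F (act y x) = (\<Sum>p\<in>P. F (act y p) * G p x)}"
      by (rule closure_minimal[rotated])
    then show ?thesis using S by auto
  qed
  have "(\<lambda>x. \<Sum>p\<in>P. F (act y p) * G p x) \<in> fs.span B" for y
    by (rule span_lincomb) (rule P(2))
  then have "(\<lambda>x. F (act y x)) \<in> fs.span B" for y by (simp only: eq[symmetric])
  then show ?thesis using B(1) unfolding fin_orbit_def by blast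
qed

text \<open>The generators are adjoined one at a time, and density is applied at the end. The action
  is abstract because the result is used twice: for translation of points and for translation of
  test functions.\<close>

lemma fin_orbit_differences:
  fixes act :: "'g::real_normed_vector \<Rightarrow> 'x \<Rightarrow> 'x" and h :: "nat \<Rightarrow> 'g"
  assumes act0: "\<And>x. act 0 x = x" and act: "\<And>y z x. act (y + z) x = act y (act z x)"
    and dense: "closure {(\<Sum>k\<in>{1..t}. real_of_int (n k) *\<^sub>R h k) | n :: nat \<Rightarrow> int. True} = UNIV"
    and cont: "\<And>x. continuous_on UNIV (\<lambda>y. F (act y x))"
    and E: "\<And>k. k \<in> {1..t} \<Longrightarrow> fin_orbit act UNIV
      (\<lambda>x. \<Sum>j\<le>m k. of_nat (m k choose j) * (-1) ^ (m k - j) * F (act (real j *\<^sub>R h k) x))"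
  shows "fin_orbit act UNIV F"
proof -
  have "fin_orbit act {(\<Sum>k\<in>{1..s}. real_of_int (n k) *\<^sub>R h k) | n :: nat \<Rightarrow> int. True} F" if "s \<le> t" for s
    using that
  proof (induction s)
    case 0
    have "fin_orbit act {0} F"
      unfolding fin_orbit_def by (rule exI[of _ "{F}"]) (auto simp: act0 intro: fs.span_base)
    then show ?case by simp
  next
    case (Suc s)
    let ?S = "{(\<Sum>k\<in>{1..s}. real_of_int (n k) *\<^sub>R h k) | n :: nat \<Rightarrow> int. True}"
    have "fin_orbit act {y + real_of_int n *\<^sub>R h (Suc s) | y n. y \<in> ?S} F"
      using Suc E[of "Suc s"] by (intro fin_orbit_extend[OF act _ E[of "Suc s"]]) auto
    moreover have "{(\<Sum>k\<in>{1..Suc s}. real_of_int (n k) *\<^sub>R h k) | n :: nat \<Rightarrow> int. True}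
        \<subseteq> {y + real_of_int n *\<^sub>R h (Suc s) | y n. y \<in> ?S}"
      by auto
    ultimately show ?case unfolding fin_orbit_def by blast
  qed
  from this[OF order_refl] show ?thesis using dense cont by (rule fin_orbit_dense)
qed

section \<open>Continuous functions on the real line\<close>

text \<open>Among \<open>card B + 1\<close> members of the span there is a linear relation. It is
  packaged as a polynomial because \<open>w i\<close> will be an \<open>i\<close>-th derivative,
  which makes \<open>p\<close> the characteristic polynomial of a differential equation.\<close>

lemma span_linear_dependence:
  fixes w :: "nat \<Rightarrow> 'x \<Rightarrow> complex"
  assumes B: "finite B" and w: "\<And>i. w i \<in> fs.span B"
  obtains p :: "complex poly" where "p \<noteq> 0" "\<And>x. (\<Sum>i\<le>degree p. coeff p i * w i x) = 0"
proof -
  define N where "N = card B"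
  have "\<exists>c. (\<exists>i\<le>N. c i \<noteq> 0) \<and> (\<forall>x. (\<Sum>i\<le>N. c i * w i x) = 0)"
  proof (cases "inj_on w {..N}")
    case True
    then have "card (w ` {..N}) = Suc N" by (simp add: card_image)
    then have "fs.dependent (w ` {..N})"
      using fs.independent_span_bound[OF B, of "w ` {..N}"] w by (auto simp: N_def)
    then obtain u where u: "\<exists>v\<in>w ` {..N}. u v \<noteq> 0" "(\<Sum>v\<in>w ` {..N}. cscale (u v) v) = 0"
      by (auto simp: fs.dependent_finite)
    have "(\<Sum>i\<le>N. cscale (u (w i)) (w i)) = 0"
      using u(2) True by (simp add: sum.reindex)
    then have "(\<Sum>i\<le>N. u (w i) * w i x) = 0" for x
      by (auto simp: fun_eq_iff sum_fun_apply cscale_apply)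
    then show ?thesis using u(1) by (intro exI[of _ "\<lambda>i. u (w i)"]) auto
  next
    \<comment> \<open>Dependence is a property of sets and does not see repetitions in a family; two
      equal members give a relation with coefficients 1 and -1.\<close>
    case False
    then obtain i j where ij: "i \<le> N" "j \<le> N" "i \<noteq> j" "w i = w j"
      by (auto simp: inj_on_def)
    define c :: "nat \<Rightarrow> complex" where "c = (\<lambda>k. if k = i then 1 else if k = j then -1 else 0)"
    have "(\<Sum>k\<le>N. c k * w k x) = 0" for x
    proof -
      have "(\<Sum>k\<le>N. c k * w k x) = (\<Sum>k\<in>{i, j}. c k * w k x)"
        using ij by (intro sum.mono_neutral_right) (auto simp: c_def)
      then show ?thesis using ij by (simp add: c_def)
    qed
    then show ?thesis using ij by (intro exI[of _ c]) (auto simp: c_def)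
  qed
  then obtain c i where c: "i \<le> N" "c i \<noteq> 0" "\<And>x. (\<Sum>i\<le>N. c i * w i x) = 0" by blast
  define p where "p = (\<Sum>i\<le>N. monom (c i) i)"
  have coeff: "coeff p k = (if k \<le> N then c k else 0)" for k
    by (auto simp: p_def coeff_sum)
  have "p \<noteq> 0" using c coeff[of i] by auto
  moreover have "(\<Sum>i\<le>degree p. coeff p i * w i x) = 0" for x
  proof -
    have "(\<Sum>i\<le>degree p. coeff p i * w i x) = (\<Sum>i\<le>N. coeff p i * w i x)"
    proof (rule sum.mono_neutral_left)
      have "degree p \<le> N" by (rule degree_le) (simp add: coeff)
      then show "{..degree p} \<subseteq> {..N}" by auto
    qed (auto simp: coeff_eq_0)
    then show ?thesis using c(3) by (simp add: coeff)
  qed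
  ultimately show ?thesis using that by blast
qed

section \<open>Exponential polynomials in one variable and linear differential equations\<close>

definition expo_real :: "(real \<Rightarrow> complex) set" where
  "expo_real = fs.span (range (\<lambda>(k::nat, \<mu>) s. of_real s ^ k * exp (\<mu> * of_real s)))"

lemma expo_real_basis: "(\<lambda>s. of_real s ^ k * exp (\<mu> * of_real s)) \<in> expo_real"
  unfolding expo_real_def by (rule fs.span_base) (rule image_eqI[of _ _ "(k, \<mu>)"], auto)

lemma expo_real_add: "f \<in> expo_real \<Longrightarrow> g \<in> expo_real \<Longrightarrow> (\<lambda>s. f s + g s) \<in> expo_real"
  unfolding expo_real_def using fs.span_add by (fastforce simp: plus_fun_def)

lemma expo_real_cmult: "f \<in> expo_real \<Longrightarrow> (\<lambda>s. c * f s) \<in> expo_real"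
  unfolding expo_real_def using fs.span_scale[of f _ c] by (simp add: cscale_def[of c f])

lemma expo_real_const: "(\<lambda>s. c) \<in> expo_real"
  using expo_real_cmult[OF expo_real_basis[of 0 0], of c] by simp

lemma expo_real_induct [consumes 1, case_names zero step]:
  assumes "g \<in> expo_real" "P (\<lambda>s. 0)"
    "\<And>c k \<mu> v. v \<in> expo_real \<Longrightarrow> P v \<Longrightarrow> P (\<lambda>s. c * (of_real s ^ k * exp (\<mu> * of_real s)) + v s)"
  shows "P g"
proof -
  have "g \<in> expo_real \<and> P g" using assms(1) unfolding expo_real_def
  proof (induction rule: fs.span_induct_alt)
    case base
    show ?case using assms(2) fs.span_zero by (simp add: zero_fun_def)
  next
    case (step c u v)
    then obtain k \<mu> where u: "u = (\<lambda>s. of_real s ^ k * exp (\<mu> * of_real s))" by auto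
    have eq: "cscale c u + v = (\<lambda>s. c * (of_real s ^ k * exp (\<mu> * of_real s)) + v s)"
      by (auto simp: u cscale_apply)
    have "cscale c u + v \<in> fs.span (range (\<lambda>(k::nat, \<mu>) s. of_real s ^ k * exp (\<mu> * of_real s)))"
      using step by (intro fs.span_add fs.span_scale) (auto intro: fs.span_base)
    moreover have "P (cscale c u + v)" unfolding eq
      using step by (intro assms(3)) (auto simp: expo_real_def)
    ultimately show ?case by blast
  qed
  then show ?thesis ..
qed

lemma expo_real_exp_mult:
  assumes "g \<in> expo_real"
  shows "(\<lambda>s. exp (\<nu> * of_real s) * g s) \<in> expo_real"
  using assms
proof (induction rule: expo_real_induct)
  case zero
  show ?case using expo_real_const[of 0] by simp
next
  case (step c k \<mu> v)
  have "(\<lambda>s. c * (of_real s ^ k * exp ((\<nu> + \<mu>) * of_real s)) + exp (\<nu> * of_real s) * v s) \<in> expo_real"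
    by (intro expo_real_add expo_real_cmult expo_real_basis step)
  moreover have "(\<lambda>s. c * (of_real s ^ k * exp ((\<nu> + \<mu>) * of_real s)) + exp (\<nu> * of_real s) * v s)
      = (\<lambda>s. exp (\<nu> * of_real s) * (c * (of_real s ^ k * exp (\<mu> * of_real s)) + v s))"
    by (simp add: algebra_simps exp_add)
  ultimately show ?case by simp
qed

text \<open>For exponent 0 the power rule applies. Otherwise integration by parts lowers the power
  of \<open>s\<close> by one, which gives an induction on \<open>k\<close>.\<close>

lemma expo_real_basis_antiderivative:
  "\<exists>G\<in>expo_real. \<forall>s. (G has_vector_derivative of_real s ^ k * exp (\<mu> * of_real s)) (at s)"
proof (cases "\<mu> = 0")
  case True
  define G :: "real \<Rightarrow> complex" where "G = (\<lambda>s. 1 / of_nat (Suc k) * (of_real s ^ Suc k * exp (0 * of_real s)))"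
  have "(G has_vector_derivative of_real s ^ k * exp (\<mu> * of_real s)) (at s)" for s
  proof -
    have "((\<lambda>z::complex. z ^ Suc k / of_nat (Suc k)) has_field_derivative of_real s ^ k) (at (of_real s))"
      by (auto intro!: derivative_eq_intros simp del: of_nat_Suc power_Suc)
    from has_vector_derivative_real_field[OF this] show ?thesis
      using True by (simp add: G_def)
  qed
  moreover have "G \<in> expo_real" unfolding G_def by (intro expo_real_cmult expo_real_basis)
  ultimately show ?thesis by blast
next
  case False
  show ?thesis
  proof (induction k)
    case 0
    have "((\<lambda>z. exp (\<mu> * z) / \<mu>) has_field_derivative exp (\<mu> * of_real s)) (at (of_real s))" for s
      using False by (auto intro!: derivative_eq_intros)
    from has_vector_derivative_real_field[OF this]
    have "((\<lambda>s. 1 / \<mu> * (of_real s ^ 0 * exp (\<mu> * of_real s))) has_vector_derivative exp (\<mu> * of_real s)) (at s)" for s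
      by simp
    then show ?case
      by (intro bexI[OF _ expo_real_cmult[OF expo_real_basis[of 0 \<mu>], of "1 / \<mu>"]]) auto
  next
    case (Suc k)
    then obtain G where G: "G \<in> expo_real"
      "\<And>s. (G has_vector_derivative of_real s ^ k * exp (\<mu> * of_real s)) (at s)" by blast
    define H where "H = (\<lambda>s. 1 / \<mu> * (of_real s ^ Suc k * exp (\<mu> * of_real s)) + (- (of_nat (Suc k) / \<mu>)) * G s)"
    have "(H has_vector_derivative of_real s ^ Suc k * exp (\<mu> * of_real s)) (at s)" for s
    proof -
      have "((\<lambda>z. z ^ Suc k * exp (\<mu> * z)) has_field_derivative
          of_nat (Suc k) * of_real s ^ k * exp (\<mu> * of_real s) + of_real s ^ Suc k * (\<mu> * exp (\<mu> * of_real s)))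
          (at (of_real s))"
        by (auto intro!: derivative_eq_intros simp del: of_nat_Suc power_Suc simp: algebra_simps)
      note has_vector_derivative_real_field[OF DERIV_cmult[OF this, of "1 / \<mu>"]]
      note deriv = has_vector_derivative_add[OF this has_vector_derivative_mult_right[OF G(2)[of s], of "- (of_nat (Suc k) / \<mu>)"]]
      have alg: "1 / \<mu> * (a * b * e + c * (\<mu> * e)) + - (a / \<mu>) * (b * e) = c * e" for a b c e
        using False by (simp add: distrib_left mult.assoc)
      show ?thesis
        unfolding H_def by (rule has_vector_derivative_eq_rhs[OF deriv]) (rule alg)
    qed
    moreover have "H \<in> expo_real" unfolding H_def by (intro expo_real_add expo_real_cmult expo_real_basis G)
    ultimately show ?case by blast
  qed
qed

lemma expo_real_antiderivative:
  assumes "g \<in> expo_real"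
  shows "\<exists>G\<in>expo_real. \<forall>s. (G has_vector_derivative g s) (at s)"
  using assms
proof (induction rule: expo_real_induct)
  case zero
  show ?case by (rule bexI[OF _ expo_real_const[of 0]]) auto
next
  case (step c k \<mu> v)
  obtain G where G: "G \<in> expo_real" "\<And>s. (G has_vector_derivative of_real s ^ k * exp (\<mu> * of_real s)) (at s)"
    using expo_real_basis_antiderivative by blast
  obtain V where V: "V \<in> expo_real" "\<And>s. (V has_vector_derivative v s) (at s)" using step by blast
  show ?case
    by (rule bexI[of _ "\<lambda>s. c * G s + V s"])
       (intro allI has_vector_derivative_add has_vector_derivative_mult_right G V expo_real_add expo_real_cmult)+
qed

text \<open>Integrating factor: after multiplication by \<open>exp (-\<mu> * of_real s)\<close> the
  solution has a derivative in \<open>expo_real\<close>, so it differs from an antiderivative in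
  \<open>expo_real\<close> by a constant.\<close>

lemma first_order_ode_expo_real:
  assumes w: "\<And>s. (w has_vector_derivative (\<mu> * w s + v s)) (at s)" and v: "v \<in> expo_real"
  shows "w \<in> expo_real"
proof -
  define z where "z = (\<lambda>s. exp (-\<mu> * of_real s) * w s)"
  obtain Z where Z: "Z \<in> expo_real" "\<And>s. (Z has_vector_derivative exp (-\<mu> * of_real s) * v s) (at s)"
    using expo_real_antiderivative[OF expo_real_exp_mult[OF v, of "-\<mu>"]] by blast
  have "(z has_vector_derivative exp (-\<mu> * of_real s) * v s) (at s)" for s
  proof -
    have "((\<lambda>z. exp (-\<mu> * z)) has_field_derivative -\<mu> * exp (-\<mu> * of_real s)) (at (of_real s))"
      by (auto intro!: derivative_eq_intros)
    note has_vector_derivative_mult[OF has_vector_derivative_real_field[OF this] w[of s]]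
    then show ?thesis unfolding z_def by (simp add: algebra_simps)
  qed
  from has_vector_derivative_diff[OF this Z(2)]
  have "((\<lambda>s. z s - Z s) has_vector_derivative 0) (at s within UNIV)" for s by simp
  then obtain c where c: "\<And>s. z s - Z s = c"
    using has_vector_derivative_zero_constant[of UNIV "\<lambda>s. z s - Z s"] by auto
  have "(\<lambda>s. Z s + c) \<in> expo_real" by (intro expo_real_add expo_real_const Z)
  moreover have "(\<lambda>s. Z s + c) = z" using c by (auto simp: algebra_simps)
  ultimately have "(\<lambda>s. exp (\<mu> * of_real s) * z s) \<in> expo_real" using expo_real_exp_mult by blast
  moreover have "exp (\<mu> * of_real s) * z s = w s" for s
    by (simp add: z_def mult.assoc[symmetric] exp_add[symmetric])
  ultimately show ?thesis by simp
qed

text \<open>\<open>w n\<close> is the \<open>n\<close>-th derivative of the solution and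
  \<open>p\<close> the characteristic polynomial. If p = (X - \<mu>) q, then w' - \<mu> w solves the
  equation belonging to q, which has smaller degree, and w is recovered from it by a first-order
  equation.\<close>

lemma linear_ode_expo_real:
  fixes p :: "complex poly" and w :: "nat \<Rightarrow> real \<Rightarrow> complex"
  assumes "p \<noteq> 0" "\<And>n s. (w n has_vector_derivative w (Suc n) s) (at s)"
    "\<And>s. (\<Sum>i\<le>degree p. coeff p i * w i s) = 0"
  shows "w 0 \<in> expo_real"
  using assms
proof (induction "degree p" arbitrary: p w)
  case 0
  then have "coeff p 0 \<noteq> 0" by (metis leading_coeff_0_iff)
  then have "w 0 s = 0" for s using 0(1) 0(4)[of s] by simp
  then have "w 0 = (\<lambda>s. 0)" by auto
  then show ?case using expo_real_const by simp
next
  case (Suc d)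
  then have "\<not> constant (poly p)" by (simp add: constant_degree)
  then obtain \<mu> where "poly p \<mu> = 0" using fundamental_theorem_of_algebra by blast
  then obtain q where q: "p = [:- \<mu>, 1:] * q" by (auto simp: poly_eq_0_iff_dvd elim: dvdE)
  with Suc have q0: "q \<noteq> 0" by auto
  then have deg: "d = degree q" using Suc(2) unfolding q by (subst (asm) degree_mult_eq) auto
  define v where "v = (\<lambda>n s. w (Suc n) s - \<mu> * w n s)"
  have "v 0 \<in> expo_real"
  proof (rule Suc(1)[OF deg q0])
    show "(v n has_vector_derivative v (Suc n) s) (at s)" for n s
      unfolding v_def by (intro has_vector_derivative_diff has_vector_derivative_mult_right Suc(4))
    show "(\<Sum>i\<le>degree q. coeff q i * v i s) = 0" for s
    proof -
      have p: "p = pCons 0 q - smult \<mu> q" by (simp add: q)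
      have "0 = (\<Sum>i\<le>Suc d. coeff p i * w i s)" using Suc(5)[of s] Suc(2) by simp
      also have "\<dots> = (\<Sum>i\<le>Suc d. coeff (pCons 0 q) i * w i s) - (\<Sum>i\<le>Suc d. \<mu> * coeff q i * w i s)"
        unfolding p by (simp only: coeff_diff coeff_smult left_diff_distrib sum_subtractf)
      \<comment> \<open>The constant coefficient of \<open>pCons 0 q\<close> is 0, so this sum
        starts at index 1 and is reindexed; in the other sum the top index \<open>Suc d\<close>
        exceeds the degree of \<open>q\<close> and drops out.\<close>
      also have "(\<Sum>i\<le>Suc d. coeff (pCons 0 q) i * w i s) = (\<Sum>i\<le>d. coeff q i * w (Suc i) s)"
        by (subst sum.atMost_Suc_shift) simp
      also have "(\<Sum>i\<le>Suc d. \<mu> * coeff q i * w i s) = (\<Sum>i\<le>d. \<mu> * coeff q i * w i s)"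
        by (simp add: deg coeff_eq_0)
      finally show ?thesis by (simp add: v_def deg algebra_simps sum_subtractf)
    qed
  qed
  then show ?case
    using Suc(4)[of 0] by (intro first_order_ode_expo_real[of "w 0" \<mu> "v 0"]) (simp_all add: v_def)
qed

section \<open>Spaces spanned by the translates of a function\<close>

lemma translate_span_shift:
  fixes f :: "'a::ab_semigroup_add \<Rightarrow> complex"
  assumes "g \<in> fs.span (range (\<lambda>y x. f (x + y)))"
  shows "(\<lambda>x. g (x + y)) \<in> fs.span (range (\<lambda>y x. f (x + y)))"
proof -
  have "(\<lambda>b x. b (x + y)) ` range (\<lambda>y x. f (x + y)) \<subseteq> range (\<lambda>y x. f (x + y))"
    by (auto simp: add.assoc)
  from fs.span_mono[OF this] show ?thesis
    using span_pullback[OF assms, of "\<lambda>x. x + y"] by blast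
qed

lemma translate_span_continuous:
  fixes f :: "'a::real_normed_vector \<Rightarrow> complex"
  assumes f: "continuous_on UNIV f" and g: "g \<in> fs.span (range (\<lambda>y x. f (x + y)))"
  shows "continuous_on UNIV g"
  using g
proof (induction rule: fs.span_induct_alt)
  case base
  show ?case by (simp add: zero_fun_def)
next
  case (step c u v)
  then obtain y where u: "u = (\<lambda>x. f (x + y))" by auto
  have "continuous_on UNIV u" unfolding u
    by (rule continuous_on_compose2[OF f]) (auto intro!: continuous_intros)
  moreover have "cscale c u + v = (\<lambda>s. c * u s + v s)" by (auto simp: cscale_apply)
  ultimately show ?case using step by (auto intro!: continuous_intros)
qed

text \<open>\<open>V\<close> collects the members of the translate span \<open>U\<close> that have a
  derivative in \<open>U\<close>. Averages of \<open>w\<close> over short intervals lie in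
  \<open>V\<close> and converge pointwise to \<open>w\<close>; being finite-dimensional,
  \<open>V\<close> contains the limit.\<close>

lemma fin_orbit_differentiable:
  fixes u :: "real \<Rightarrow> complex"
  assumes cont: "continuous_on UNIV u" and B: "finite B" "\<And>t. (\<lambda>s. u (s + t)) \<in> fs.span B"
    and w: "w \<in> fs.span (range (\<lambda>t s. u (s + t)))"
  shows "\<exists>w'\<in>fs.span (range (\<lambda>t s. u (s + t))). \<forall>s. (w has_vector_derivative w' s) (at s)"
proof -
  define U where "U = fs.span (range (\<lambda>t s. u (s + t)))"
  have UB: "U \<subseteq> fs.span B" unfolding U_def using B by (intro fs.span_minimal) auto
  have sub: "fs.subspace U" unfolding U_def by (rule fs.subspace_span)
  note shift = translate_span_shift[where f = u, folded U_def]
    and contU = translate_span_continuous[OF cont, folded U_def]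
  define V where "V = {g\<in>U. \<exists>g'\<in>U. \<forall>s. (g has_vector_derivative g' s) (at s)}"
  have subV: "fs.subspace V"
  proof (rule fs.subspaceI)
    have "\<forall>s. ((0 :: real \<Rightarrow> complex) has_vector_derivative 0 s) (at s)" by (simp add: zero_fun_def)
    then show "0 \<in> V" using fs.subspace_0[OF sub] unfolding V_def by blast
  next
    fix x y assume "x \<in> V" "y \<in> V"
    then obtain x' y' where d: "x \<in> U" "y \<in> U" "x' \<in> U" "y' \<in> U"
      "\<And>s. (x has_vector_derivative x' s) (at s)" "\<And>s. (y has_vector_derivative y' s) (at s)"
      unfolding V_def by blast
    have "\<forall>s. (x + y has_vector_derivative (x' + y') s) (at s)"
      using has_vector_derivative_add[OF d(5,6)] by (simp add: plus_fun_def)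
    then show "x + y \<in> V" using d sub unfolding V_def by (blast intro: fs.subspace_add)
  next
    fix x c assume "x \<in> V"
    then obtain x' where d: "x \<in> U" "x' \<in> U" "\<And>s. (x has_vector_derivative x' s) (at s)"
      unfolding V_def by blast
    have "\<forall>s. (cscale c x has_vector_derivative (cscale c x') s) (at s)"
      using has_vector_derivative_mult_right[OF d(3), of c] by (simp add: cscale_def)
    then show "cscale c x \<in> V" using d sub unfolding V_def by (blast intro: fs.subspace_scale)
  qed
  \<comment> \<open>The expansion in \<open>U\<close> will show that averages stay in
    \<open>U\<close>; the separate expansion in \<open>V\<close> will carry the limit.\<close>
  obtain P G where P: "finite P" "\<And>p. p \<in> P \<Longrightarrow> G p \<in> U"
    and L: "\<And>g x. g \<in> U \<Longrightarrow> g x = (\<Sum>p\<in>P. g p * G p x)"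
    using lagrange_subspace[OF B(1) UB sub] by metis
  have "V \<subseteq> fs.span B" using UB by (auto simp: V_def)
  then obtain Q H where Q: "finite Q" "\<And>p. p \<in> Q \<Longrightarrow> H p \<in> V"
    and M: "\<And>g x. g \<in> V \<Longrightarrow> g x = (\<Sum>p\<in>Q. g p * H p x)"
    using lagrange_subspace[OF B(1) _ subV] by metis
  have wU: "w \<in> U" using w by (simp add: U_def)
  obtain W where W: "\<And>s. (W has_vector_derivative w s) (at s)"
    using einterval_antiderivative[of "-\<infinity>" "\<infinity>" w] contU[OF wU]
    by (auto simp: continuous_on_eq_continuous_at)
  \<comment> \<open>The average of \<open>w\<close> over \<open>[s, s + \<delta>]\<close>; it lies in \<open>V\<close> and tends to \<open>w\<close> as \<open>\<delta>\<close> tends to 0.\<close>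
  define A where "A = (\<lambda>\<delta> s. (W (s + \<delta>) - W s) / of_real \<delta>)"
  have AV: "A \<delta> \<in> V" if d: "\<delta> > 0" for \<delta>
  proof -
    have int: "((\<lambda>r. w (s + r)) has_integral W (s + \<delta>) - W s) {0..\<delta>}" for s
    proof -
      have "((\<lambda>r. w (s + r)) has_integral W (s + \<delta>) - W (s + 0)) {0..\<delta>}"
      proof (rule fundamental_theorem_of_calculus)
        show "0 \<le> \<delta>" using d by simp
        fix r assume "r \<in> {0..\<delta>}"
        have "((\<lambda>r. s + r) has_vector_derivative 1) (at r within {0..\<delta>})"
          by (auto intro!: derivative_eq_intros)
        from vector_diff_chain_within[OF this has_vector_derivative_at_within[OF W]]
        show "((\<lambda>r. W (s + r)) has_vector_derivative w (s + r)) (at r within {0..\<delta>})"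
          by (simp add: o_def)
      qed
      then show ?thesis by simp
    qed
    have "A \<delta> s = (\<Sum>p\<in>P. A \<delta> p * G p s)" for s
    proof -
      \<comment> \<open>The translate of \<open>w\<close> by \<open>r\<close> has the coefficients
        \<open>w (p + r)\<close>; its expansion at the point \<open>s\<close> is integrated over
        \<open>r\<close>.\<close>
      have "((\<lambda>r. \<Sum>p\<in>P. w (p + r) * G p s) has_integral (\<Sum>p\<in>P. (W (p + \<delta>) - W p) * G p s)) {0..\<delta>}"
        using P(1) by (intro has_integral_sum has_integral_mult_left int)
      moreover have "(\<Sum>p\<in>P. w (p + r) * G p s) = w (s + r)" for r
        using L[OF shift[OF wU, of r], of s] by simp
      ultimately have "W (s + \<delta>) - W s = (\<Sum>p\<in>P. (W (p + \<delta>) - W p) * G p s)"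
        using int[of s] by (simp add: has_integral_unique)
      then show ?thesis by (simp add: A_def sum_divide_distrib)
    qed
    then have eq: "A \<delta> = (\<lambda>s. \<Sum>p\<in>P. A \<delta> p * G p s)" by (rule ext)
    have AU: "A \<delta> \<in> U"
      by (subst eq) (use P(2) in \<open>auto simp: U_def intro!: span_lincomb\<close>)
    \<comment> \<open>The derivative of the average is the difference quotient of \<open>w\<close>,
      a combination of two translates and hence in \<open>U\<close>.\<close>
    define D where "D = cscale (1 / of_real \<delta>) ((\<lambda>s. w (s + \<delta>)) - w)"
    have "D \<in> U" unfolding D_def using sub wU shift by (intro fs.subspace_scale fs.subspace_diff)
    moreover have "(A \<delta> has_vector_derivative D s) (at s)" for s
    proof -
      have "((\<lambda>s. s + \<delta>) has_vector_derivative 1) (at s)" by (auto intro!: derivative_eq_intros)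
      from vector_diff_chain_at[OF this W]
      have "((\<lambda>s. W (s + \<delta>)) has_vector_derivative w (s + \<delta>)) (at s)" by (simp add: o_def)
      from has_vector_derivative_mult_right[OF has_vector_derivative_diff[OF this W], of "1 / of_real \<delta>"]
      show ?thesis by (simp add: A_def D_def cscale_apply)
    qed
    ultimately show ?thesis using AU unfolding V_def by blast
  qed
  have lim: "(\<lambda>n. A (1 / real (Suc n)) s) \<longlonglongrightarrow> w s" for s
  proof -
    have "((\<lambda>h. norm (W (s + h) - W s - h *\<^sub>R w s) / norm h) \<longlongrightarrow> 0) (at 0)"
      using W[of s] by (simp add: has_vector_derivative_def has_derivative_at)
    moreover have "filterlim (\<lambda>n. 1 / real (Suc n)) (at 0) sequentially"
      by (intro filterlim_atI LIMSEQ_Suc[OF lim_1_over_n]) auto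
    ultimately have "(\<lambda>n. norm (W (s + 1 / real (Suc n)) - W s - (1 / real (Suc n)) *\<^sub>R w s)
        / norm (1 / real (Suc n))) \<longlonglongrightarrow> 0"
      by (rule filterlim_compose)
    moreover have quot: "norm (W (s + h) - W s - h *\<^sub>R w s) / norm h = norm (A h s - w s)" if "h > 0" for h
    proof -
      have "A h s - w s = (W (s + h) - W s - h *\<^sub>R w s) / of_real h"
        using that by (simp add: A_def scaleR_conv_of_real field_simps)
      then show ?thesis using that by (simp add: norm_divide)
    qed
    moreover have "norm (W (s + 1 / real (Suc n)) - W s - (1 / real (Suc n)) *\<^sub>R w s) / norm (1 / real (Suc n))
        = norm (A (1 / real (Suc n)) s - w s)" for n by (rule quot) simp
    ultimately have "(\<lambda>n. norm (A (1 / real (Suc n)) s - w s)) \<longlonglongrightarrow> 0" by (simp only:)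
    then show ?thesis by (simp add: tendsto_norm_zero_iff LIM_zero_cancel)
  qed
  \<comment> \<open>In the expansion of the averages with respect to \<open>V\<close>, only finitely
    many node values have to converge.\<close>
  have "w s = (\<Sum>p\<in>Q. w p * H p s)" for s
  proof (rule LIMSEQ_unique[OF lim])
    have "(\<lambda>n. \<Sum>p\<in>Q. A (1 / real (Suc n)) p * H p s) \<longlonglongrightarrow> (\<Sum>p\<in>Q. w p * H p s)"
      by (intro tendsto_intros lim)
    moreover have "A (1 / real (Suc n)) s = (\<Sum>p\<in>Q. A (1 / real (Suc n)) p * H p s)" for n
      by (rule M[OF AV]) simp
    ultimately show "(\<lambda>n. A (1 / real (Suc n)) s) \<longlonglongrightarrow> (\<Sum>p\<in>Q. w p * H p s)" by presburger
  qed
  then have eq: "w = (\<lambda>s. \<Sum>p\<in>Q. w p * H p s)" by (rule ext)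
  have "w \<in> fs.span V"
    by (subst eq) (intro span_lincomb fs.span_base Q(2))
  then have "w \<in> V" using fs.span_minimal[OF order_refl subV] by blast
  then show ?thesis by (auto simp: V_def U_def)
qed

text \<open>Differentiation maps the finite-dimensional space \<open>U\<close> into itself, so the
  iterated derivatives of \<open>u\<close> are linearly dependent. This is a linear differential
  equation with constant coefficients.\<close>

lemma fin_orbit_expo_real:
  fixes u :: "real \<Rightarrow> complex"
  assumes cont: "continuous_on UNIV u" and B: "finite B" "\<And>t. (\<lambda>s. u (s + t)) \<in> fs.span B"
  shows "u \<in> expo_real"
proof -
  define U where "U = fs.span (range (\<lambda>t s. u (s + t)))"
  have UB: "U \<subseteq> fs.span B" unfolding U_def using B by (intro fs.span_minimal) auto
  have "\<forall>w\<in>U. \<exists>w'\<in>U. \<forall>s. (w has_vector_derivative w' s) (at s)"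
    unfolding U_def using fin_orbit_differentiable[OF cont B] by blast
  then obtain D where D: "\<And>w. w \<in> U \<Longrightarrow> D w \<in> U"
    "\<And>w s. w \<in> U \<Longrightarrow> (w has_vector_derivative D w s) (at s)" by metis
  have u: "u \<in> U" unfolding U_def by (rule fs.span_base) (rule image_eqI[of _ _ 0], auto)
  define w where "w = (\<lambda>n. (D ^^ n) u)"
  have wU: "w n \<in> U" for n by (induction n) (auto simp: w_def u D)
  then have wB: "w n \<in> fs.span B" for n using UB by blast
  obtain p :: "complex poly" where "p \<noteq> 0" "\<And>x. (\<Sum>i\<le>degree p. coeff p i * w i x) = 0"
    using span_linear_dependence[of B w] B(1) wB by blast
  moreover have "(w n has_vector_derivative w (Suc n) s) (at s)" for n s
    using D(2)[OF wU[of n]] by (simp add: w_def)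
  ultimately have "w 0 \<in> expo_real" by (intro linear_ode_expo_real)
  then show ?thesis by (simp add: w_def)
qed

section \<open>Exponential polynomials on Euclidean space\<close>

lemma span_mult:
  fixes f g :: "'x \<Rightarrow> complex"
  assumes AB: "\<And>a b. a \<in> A \<Longrightarrow> b \<in> B \<Longrightarrow> (\<lambda>x. a x * b x) \<in> fs.span C"
    and f: "f \<in> fs.span A" and g: "g \<in> fs.span B"
  shows "(\<lambda>x. f x * g x) \<in> fs.span C"
proof -
  have a: "(\<lambda>x. a x * g x) \<in> fs.span C" if "a \<in> A" for a
    using g
  proof (induction rule: fs.span_induct_alt)
    case base
    show ?case using fs.span_zero by (simp add: zero_fun_def)
  next
    case (step c u v)
    have "(\<lambda>x. a x * (cscale c u + v) x) = cscale c (\<lambda>x. a x * u x) + (\<lambda>x. a x * v x)"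
      by (auto simp: cscale_apply algebra_simps)
    moreover have "cscale c (\<lambda>x. a x * u x) + (\<lambda>x. a x * v x) \<in> fs.span C"
      using step AB that by (intro fs.span_add fs.span_scale)
    ultimately show ?case by simp
  qed
  show ?thesis using f
  proof (induction rule: fs.span_induct_alt)
    case base
    show ?case using fs.span_zero by (simp add: zero_fun_def)
  next
    case (step c u v)
    have "(\<lambda>x. (cscale c u + v) x * g x) = cscale c (\<lambda>x. u x * g x) + (\<lambda>x. v x * g x)"
      by (auto simp: cscale_apply algebra_simps)
    moreover have "cscale c (\<lambda>x. u x * g x) + (\<lambda>x. v x * g x) \<in> fs.span C"
      using step a by (intro fs.span_add fs.span_scale)
    ultimately show ?case by simp
  qed
qed

definition expo_basis :: "((real^'n) \<Rightarrow> complex) set" where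
  "expo_basis = range (\<lambda>(\<alpha>, l) x. monomial_fn \<alpha> x * exp (cinner l x))"

text \<open>The description as a span gives closure under linear combinations at once and allows
  induction over single terms, without bookkeeping for \<open>r\<close>, \<open>p\<close> and
  \<open>lam\<close>.\<close>

lemma expo_poly_iff_span: "expo_poly e \<longleftrightarrow> e \<in> fs.span expo_basis"
proof
  assume "expo_poly e"
  then obtain r :: nat and p lam where p: "\<And>j. j < r \<Longrightarrow> poly_fn (p j)"
    and e: "\<And>x. e x = (\<Sum>j<r. p j x * exp (cinner (lam j) x))"
    unfolding expo_poly_def by blast
  have "(\<lambda>x. p j x * exp (cinner (lam j) x)) \<in> fs.span expo_basis" if j: "j < r" for j
  proof -
    obtain A c where A: "finite A" "\<And>x. p j x = (\<Sum>\<alpha>\<in>A. c \<alpha> * monomial_fn \<alpha> x)"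
      using p[OF j] unfolding poly_fn_def by blast
    have "(\<lambda>x. \<Sum>\<alpha>\<in>A. c \<alpha> * (monomial_fn \<alpha> x * exp (cinner (lam j) x))) \<in> fs.span expo_basis"
      by (intro span_lincomb fs.span_base) (auto simp: expo_basis_def)
    then show ?thesis by (simp add: A(2) sum_distrib_right mult.assoc)
  qed
  then have "(\<lambda>x. \<Sum>j<r. 1 * (p j x * exp (cinner (lam j) x))) \<in> fs.span expo_basis"
    by (intro span_lincomb) auto
  moreover have "e = (\<lambda>x. \<Sum>j<r. 1 * (p j x * exp (cinner (lam j) x)))" by (simp add: fun_eq_iff e)
  ultimately show "e \<in> fs.span expo_basis" by simp
next
  assume "e \<in> fs.span expo_basis"
  then show "expo_poly e"
  proof (induction rule: fs.span_induct_alt)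
    case base
    show ?case unfolding expo_poly_def by (rule exI[of _ 0]) auto
  next
    case (step c u v)
    obtain \<alpha> l where u: "\<And>x. u x = monomial_fn \<alpha> x * exp (cinner l x)"
      using step(1) by (auto simp: expo_basis_def)
    obtain r :: nat and p lam where p: "\<And>j. j < r \<Longrightarrow> poly_fn (p j)"
      and v: "\<And>x. v x = (\<Sum>j<r. p j x * exp (cinner (lam j) x))"
      using step(2) unfolding expo_poly_def by blast
    have "poly_fn (\<lambda>x. c * monomial_fn \<alpha> x)"
      unfolding poly_fn_def by (rule exI[of _ "{\<alpha>}"]) auto
    then show ?case unfolding expo_poly_def
      by (intro exI[of _ "Suc r"] exI[of _ "p(r := (\<lambda>x. c * monomial_fn \<alpha> x))"] exI[of _ "lam(r := l)"])
         (auto simp: p v u cscale_apply less_Suc_eq algebra_simps)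
  qed
qed

lemma expo_poly_lincomb:
  "(\<And>i. i \<in> I \<Longrightarrow> expo_poly (g i)) \<Longrightarrow> expo_poly (\<lambda>x. \<Sum>i\<in>I. c i * g i x)"
  unfolding expo_poly_iff_span by (rule span_lincomb)

lemma expo_poly_add: "expo_poly f \<Longrightarrow> expo_poly g \<Longrightarrow> expo_poly (\<lambda>x. f x + g x)"
  unfolding expo_poly_iff_span using fs.span_add by (fastforce simp: plus_fun_def)

lemma expo_poly_mult: "expo_poly f \<Longrightarrow> expo_poly g \<Longrightarrow> expo_poly (\<lambda>x. f x * g x)"
  unfolding expo_poly_iff_span
proof (erule span_mult[rotated], assumption)
  fix a b :: "(real^'n) \<Rightarrow> complex" assume "a \<in> expo_basis" "b \<in> expo_basis"
  then obtain \<alpha> l \<beta> k where ab: "a = (\<lambda>x. monomial_fn \<alpha> x * exp (cinner l x))"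
    "b = (\<lambda>x. monomial_fn \<beta> x * exp (cinner k x))" by (auto simp: expo_basis_def)
  have "a x * b x = monomial_fn (\<lambda>i. \<alpha> i + \<beta> i) x * exp (cinner (l + k) x)" for x
    by (simp add: ab monomial_fn_def cinner_def power_add prod.distrib distrib_right sum.distrib exp_add)
  then have "(\<lambda>x. a x * b x) \<in> expo_basis"
    unfolding expo_basis_def by (intro image_eqI[of _ _ "(\<lambda>i. \<alpha> i + \<beta> i, l + k)"]) auto
  then show "(\<lambda>x. a x * b x) \<in> fs.span expo_basis" by (rule fs.span_base)
qed

lemma expo_poly_basis: "expo_poly (\<lambda>x. monomial_fn \<alpha> x * exp (cinner l x))"
  unfolding expo_poly_iff_span expo_basis_def
  by (intro fs.span_base image_eqI[of _ _ "(\<alpha>, l)"]) auto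

lemma expo_poly_const: "expo_poly (\<lambda>x. c)"
proof -
  have "expo_poly (\<lambda>x. \<Sum>i\<in>{()}. c * (monomial_fn (\<lambda>i. 0) x * exp (cinner 0 x)))"
    by (intro expo_poly_lincomb expo_poly_basis)
  then show ?thesis by (simp add: monomial_fn_def cinner_def)
qed

text \<open>A power of one coordinate is a monomial whose exponents are concentrated at
  \<open>i\<close>, and an exponential in that coordinate has the frequency vector
  \<open>axis i \<mu>\<close>.\<close>

lemma expo_poly_coordinate:
  assumes "u \<in> expo_real"
  shows "expo_poly (\<lambda>x. u (x $ i))"
  using assms
proof (induction rule: expo_real_induct)
  case zero
  show ?case by (rule expo_poly_const)
next
  case (step c k \<mu> v)
  have "monomial_fn (\<lambda>j. if j = i then k else 0) x = of_real (x $ i) ^ k" for x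
    by (simp add: monomial_fn_def if_distrib[of "\<lambda>n. _ ^ n"] prod.delta cong: if_cong)
  moreover have "cinner (axis i \<mu>) x = \<mu> * of_real (x $ i)" for x
    by (simp add: cinner_def axis_def if_distrib[of "\<lambda>n. n * _"] sum.delta cong: if_cong)
  ultimately have "expo_poly (\<lambda>x. of_real (x $ i) ^ k * exp (\<mu> * of_real (x $ i)))"
    using expo_poly_basis[of "\<lambda>j. if j = i then k else 0" "axis i \<mu>"] by simp
  then show ?case by (rule expo_poly_add[OF expo_poly_mult[OF expo_poly_const] step(2)])
qed

section \<open>Finite-dimensional orbits of exponential polynomials\<close>

lemma fin_orbit_mult:
  assumes "fin_orbit act S f" "fin_orbit act S g"
  shows "fin_orbit act S (\<lambda>x. f x * g x)"
proof -
  obtain A where A: "finite A" "\<And>y. y \<in> S \<Longrightarrow> (\<lambda>x. f (act y x)) \<in> fs.span A"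
    using assms by (auto simp: fin_orbit_def)
  obtain B where B: "finite B" "\<And>y. y \<in> S \<Longrightarrow> (\<lambda>x. g (act y x)) \<in> fs.span B"
    using assms by (auto simp: fin_orbit_def)
  have "(\<lambda>x. f (act y x) * g (act y x)) \<in> fs.span ((\<lambda>(a, b) x. a x * b x) ` (A \<times> B))" if "y \<in> S" for y
    using A(2)[OF that] B(2)[OF that] by (rule span_mult[rotated]) (auto intro!: fs.span_base)
  then show ?thesis
    unfolding fin_orbit_def using A B by (intro exI[of _ "(\<lambda>(a, b) x. a x * b x) ` (A \<times> B)"]) auto
qed

lemma fin_orbit_scale_add:
  assumes "fin_orbit act S f" "fin_orbit act S g"
  shows "fin_orbit act S (\<lambda>x. c * f x + g x)"
proof -
  obtain A where A: "finite A" "\<And>y. y \<in> S \<Longrightarrow> (\<lambda>x. f (act y x)) \<in> fs.span A"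
    using assms by (auto simp: fin_orbit_def)
  obtain B where B: "finite B" "\<And>y. y \<in> S \<Longrightarrow> (\<lambda>x. g (act y x)) \<in> fs.span B"
    using assms by (auto simp: fin_orbit_def)
  have "(\<lambda>x. c * f (act y x) + g (act y x)) \<in> fs.span (A \<union> B)" if "y \<in> S" for y
  proof -
    have "cscale c (\<lambda>x. f (act y x)) + (\<lambda>x. g (act y x)) \<in> fs.span (A \<union> B)"
      using A(2)[OF that] B(2)[OF that] fs.span_mono[of A "A \<union> B"] fs.span_mono[of B "A \<union> B"]
      by (intro fs.span_add fs.span_scale) auto
    moreover have "cscale c (\<lambda>x. f (act y x)) + (\<lambda>x. g (act y x)) = (\<lambda>x. c * f (act y x) + g (act y x))"
      by (auto simp: cscale_apply)
    ultimately show ?thesis by simp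
  qed
  then show ?thesis
    unfolding fin_orbit_def using A B by (intro exI[of _ "A \<union> B"]) auto
qed

lemma fin_orbit_const: "fin_orbit act S (\<lambda>x. c)"
  unfolding fin_orbit_def by (rule exI[of _ "{\<lambda>x. c}"]) (auto intro: fs.span_base)

text \<open>Translating a coordinate adds a constant, and translating an exponential multiplies it
  by a constant. Finite-dimensionality of orbits survives products and linear combinations, so it
  reaches every exponential polynomial.\<close>

lemma fin_orbit_expo_poly:
  fixes e :: "(real^'n) \<Rightarrow> complex"
  assumes "expo_poly e"
  shows "fin_orbit (\<lambda>y x. x + y) UNIV e"
proof -
  have coord: "fin_orbit (\<lambda>y x. x + y) UNIV (\<lambda>x::real^'n. complex_of_real (x $ i))" for i
  proof -
    have "(\<lambda>x::real^'n. complex_of_real ((x + y) $ i)) \<in> fs.span {\<lambda>x. of_real (x $ i), \<lambda>x. 1}" for y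
    proof -
      have "(\<lambda>x::real^'n. of_real (x $ i)) + cscale (of_real (y $ i)) (\<lambda>x. 1)
          \<in> fs.span {\<lambda>x. complex_of_real (x $ i), \<lambda>x. 1}"
        by (intro fs.span_add fs.span_scale fs.span_base) auto
      moreover have "(\<lambda>x::real^'n. of_real (x $ i)) + cscale (of_real (y $ i)) (\<lambda>x. 1)
          = (\<lambda>x. complex_of_real ((x + y) $ i))"
        by (auto simp: cscale_apply)
      ultimately show ?thesis by simp
    qed
    then show ?thesis unfolding fin_orbit_def by (intro exI[of _ "{\<lambda>x. of_real (x $ i), \<lambda>x. 1}"]) auto
  qed
  have power: "fin_orbit (\<lambda>y x. x + y) UNIV (\<lambda>x::real^'n. complex_of_real (x $ i) ^ k)" for i k
    by (induction k) (auto intro: fin_orbit_const fin_orbit_mult coord)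
  have mono: "fin_orbit (\<lambda>y x. x + y) UNIV (monomial_fn \<alpha> :: (real^'n) \<Rightarrow> complex)" for \<alpha>
  proof -
    have "fin_orbit (\<lambda>y x. x + y) UNIV (\<lambda>x::real^'n. \<Prod>i\<in>J. complex_of_real (x $ i) ^ \<alpha> i)" if "finite J" for J
      using that by induction (auto intro: fin_orbit_const fin_orbit_mult power)
    from this[of UNIV] show ?thesis by (simp add: monomial_fn_def[abs_def])
  qed
  have expo: "fin_orbit (\<lambda>y x. x + y) UNIV (\<lambda>x::real^'n. exp (cinner l x))" for l
  proof -
    have "(\<lambda>x::real^'n. exp (cinner l (x + y))) \<in> fs.span {\<lambda>x. exp (cinner l x)}" for y
    proof -
      have "cscale (exp (cinner l y)) (\<lambda>x::real^'n. exp (cinner l x)) \<in> fs.span {\<lambda>x. exp (cinner l x)}"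
        by (intro fs.span_scale fs.span_base) auto
      moreover have "cscale (exp (cinner l y)) (\<lambda>x::real^'n. exp (cinner l x)) = (\<lambda>x. exp (cinner l (x + y)))"
        by (auto simp: cscale_apply cinner_def distrib_left sum.distrib exp_add mult.commute)
      ultimately show ?thesis by simp
    qed
    then show ?thesis unfolding fin_orbit_def by (intro exI[of _ "{\<lambda>x. exp (cinner l x)}"]) auto
  qed
  show ?thesis using assms unfolding expo_poly_iff_span
  proof (induction rule: fs.span_induct_alt)
    case base
    show ?case using fin_orbit_const[of _ _ 0] by (simp add: zero_fun_def)
  next
    case (step c u v)
    then obtain \<alpha> l where u: "u = (\<lambda>x. monomial_fn \<alpha> x * exp (cinner l x))"
      by (auto simp: expo_basis_def)
    have "cscale c u + v = (\<lambda>x. c * u x + v x)" by (auto simp: cscale_apply)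
    moreover have "fin_orbit (\<lambda>y x. x + y) UNIV (\<lambda>x. c * u x + v x)"
      unfolding u by (intro fin_orbit_scale_add fin_orbit_mult mono expo step)
    ultimately show ?case by simp
  qed
qed

text \<open>One coordinate after another moves out of the argument of the basis functions
  \<open>G p\<close> into coefficients that are exponential polynomials; at the end the
  \<open>G p\<close> are evaluated at 0.\<close>

lemma expo_poly_of_fin_orbit:
  fixes f :: "(real^'n) \<Rightarrow> complex"
  assumes cont: "continuous_on UNIV f" and fin: "fin_orbit (\<lambda>y x. x + y) UNIV f"
  shows "expo_poly f"
proof -
  obtain B where B: "finite B" "\<And>y. (\<lambda>x. f (x + y)) \<in> fs.span B"
    using fin by (auto simp: fin_orbit_def)
  define U where "U = fs.span (range (\<lambda>y x. f (x + y)))"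
  have UB: "U \<subseteq> fs.span B" unfolding U_def using B by (intro fs.span_minimal) auto
  have sub: "fs.subspace U" unfolding U_def by (rule fs.subspace_span)
  note shift = translate_span_shift[where f = f, folded U_def]
    and contU = translate_span_continuous[OF cont, folded U_def]
  obtain P G where P: "finite P" "\<And>p. p \<in> P \<Longrightarrow> G p \<in> U"
    and L: "\<And>g x. g \<in> U \<Longrightarrow> g x = (\<Sum>p\<in>P. g p * G p x)"
    using lagrange_subspace[OF B(1) UB sub] by metis
  \<comment> \<open>Along a line, the orbit of \<open>g\<close> lies in the restriction of a
    finite-dimensional space, so the one-variable result applies.\<close>
  have line: "(\<lambda>s. g (q + s *\<^sub>R v)) \<in> expo_real" if g: "g \<in> U" for g q v
  proof (rule fin_orbit_expo_real)
    show "continuous_on UNIV (\<lambda>s. g (q + s *\<^sub>R v))"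
      by (rule continuous_on_compose2[OF contU[OF g]]) (auto intro!: continuous_intros)
    show "finite ((\<lambda>b s. b (q + s *\<^sub>R v)) ` B)" using B by simp
    show "(\<lambda>s. g (q + (s + t) *\<^sub>R v)) \<in> fs.span ((\<lambda>b s. b (q + s *\<^sub>R v)) ` B)" for t
      using span_pullback[of "\<lambda>x. g (x + t *\<^sub>R v)" B "\<lambda>s. q + s *\<^sub>R v"] shift[OF g] UB
      by (auto simp: scaleR_add_left add.assoc)
  qed
  \<comment> \<open>\<open>J\<close> is the set of coordinates already split off: the argument of
    \<open>G p\<close> is \<open>x\<close> with the coordinates in \<open>J\<close> set to
    0.\<close>
  have "\<exists>\<epsilon>. (\<forall>p\<in>P. expo_poly (\<epsilon> p)) \<and> (\<forall>x. f x = (\<Sum>p\<in>P. \<epsilon> p x * G p (x - (\<Sum>i\<in>J. x $ i *\<^sub>R axis i 1))))"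
    if "finite J" for J
    using that
  proof induction
    case empty
    have "f \<in> U" unfolding U_def by (rule fs.span_base) (rule image_eqI[of _ _ 0], auto)
    note f = L[OF this]
    show ?case
    proof (intro exI[of _ "\<lambda>p x. f p"] conjI ballI allI expo_poly_const)
      show "f x = (\<Sum>p\<in>P. f p * G p (x - (\<Sum>i\<in>{}. x $ i *\<^sub>R axis i 1)))" for x
        using f[of x] by (simp only: sum.empty diff_zero)
    qed
  next
    case (insert i J)
    then obtain \<epsilon> where \<epsilon>: "\<And>p. p \<in> P \<Longrightarrow> expo_poly (\<epsilon> p)"
      "\<And>x. f x = (\<Sum>p\<in>P. \<epsilon> p x * G p (x - (\<Sum>i\<in>J. x $ i *\<^sub>R axis i 1)))" by blast
    \<comment> \<open>The translate of \<open>G p\<close> along axis \<open>i\<close> is expanded at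
      the nodes \<open>q\<close>. The coefficients are values of \<open>G p\<close> on the
      axis-parallel line through \<open>q\<close>, hence exponential polynomials in
      \<open>x $ i\<close> alone.\<close>
    define \<eta> where "\<eta> = (\<lambda>q x. \<Sum>p\<in>P. 1 * (\<epsilon> p x * G p (q + (x $ i) *\<^sub>R axis i 1)))"
    have "expo_poly (\<eta> q)" for q
      unfolding \<eta>_def
      by (intro expo_poly_lincomb expo_poly_mult \<epsilon> expo_poly_coordinate[where u = "\<lambda>s. G _ (q + s *\<^sub>R axis i 1)"]
          line P(2))
    moreover have "f x = (\<Sum>q\<in>P. \<eta> q x * G q (x - (\<Sum>i\<in>insert i J. x $ i *\<^sub>R axis i 1)))" for x
    proof -
      define z where "z = x - (\<Sum>i\<in>insert i J. x $ i *\<^sub>R axis i 1)"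
      have z: "x - (\<Sum>i\<in>J. x $ i *\<^sub>R axis i 1) = z + x $ i *\<^sub>R axis i 1"
        using insert by (simp add: z_def)
      have "f x = (\<Sum>p\<in>P. \<epsilon> p x * G p (z + x $ i *\<^sub>R axis i 1))" using \<epsilon>(2)[of x] z by simp
      also have "\<dots> = (\<Sum>p\<in>P. \<epsilon> p x * (\<Sum>q\<in>P. G p (q + x $ i *\<^sub>R axis i 1) * G q z))"
        by (intro sum.cong refl arg_cong2[of _ _ _ _ "(*)"] L[OF shift[OF P(2)], simplified])
      also have "\<dots> = (\<Sum>q\<in>P. \<eta> q x * G q z)"
        unfolding \<eta>_def sum_distrib_left sum_distrib_right
        by (subst sum.swap) (simp add: mult.assoc)
      finally show ?thesis by (simp add: z_def)
    qed
    ultimately show ?case by (intro exI[of _ \<eta>]) auto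
  qed
  from this[of UNIV] obtain \<epsilon> where \<epsilon>: "\<And>p. p \<in> P \<Longrightarrow> expo_poly (\<epsilon> p)"
    "\<And>x. f x = (\<Sum>p\<in>P. \<epsilon> p x * G p (x - (\<Sum>i\<in>UNIV. x $ i *\<^sub>R axis i 1)))" by auto
  have "(\<Sum>i\<in>UNIV. x $ i *\<^sub>R axis i 1) = x" for x :: "real^'n"
    by (simp add: vec_eq_iff axis_def if_distrib sum.delta cong: if_cong)
  then have f: "f x = (\<Sum>p\<in>P. G p 0 * \<epsilon> p x)" for x using \<epsilon>(2)[of x] by (simp add: mult.commute)
  have "expo_poly (\<lambda>x. \<Sum>p\<in>P. G p 0 * \<epsilon> p x)" by (intro expo_poly_lincomb \<epsilon>)
  then show ?thesis unfolding f[symmetric] .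
qed

lemma expo_poly_of_differences:
  fixes f :: "(real^'n) \<Rightarrow> complex"
  assumes "dense_subgroup t h" "continuous_on UNIV f"
    "\<And>k. k \<in> {1..t} \<Longrightarrow> expo_poly (fdiff (h k) (m k) f)"
  shows "expo_poly f"
proof (rule expo_poly_of_fin_orbit)
  show "fin_orbit (\<lambda>y x. x + y) UNIV f"
  proof (rule fin_orbit_differences[where t = t and h = h and m = m])
    show "continuous_on UNIV (\<lambda>y. f (x + y))" for x
      by (rule continuous_on_compose2[OF assms(2)]) (auto intro!: continuous_intros)
    show "fin_orbit (\<lambda>y x. x + y) UNIV (\<lambda>x. \<Sum>j\<le>m k. of_nat (m k choose j) * (-1) ^ (m k - j) * f (x + real j *\<^sub>R h k))"
      if "k \<in> {1..t}" for k
      using fin_orbit_expo_poly[OF assms(3)[OF that]] by (simp add: fdiff_def[abs_def])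
  qed (use assms(1) in \<open>auto simp: dense_subgroup_def add_ac\<close>)
qed fact

section \<open>Smooth functions and test functions\<close>

lemma pderivs_snoc: "pderivs (js @ [i]) f = pderivs js (pderiv_fn i f)"
  by (induction js) auto

text \<open>Coinduction for smoothness: no formula for iterated derivatives is needed, only a class
  of continuous functions that is invariant under a single partial differentiation.\<close>

lemma smooth_fn_coinduct:
  assumes "P f" and cont: "\<And>f. P f \<Longrightarrow> continuous_on UNIV f"
    and deriv: "\<And>f i. P f \<Longrightarrow> \<exists>g. P g \<and> (\<forall>x. ((\<lambda>t. f (x + t *\<^sub>R axis i 1)) has_vector_derivative g x) (at 0))"
  shows "smooth_fn f"
proof -
  have "P (pderivs js f)" for js
  proof (induction js)
    case Nil
    show ?case using assms(1) by simp
  next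
    case (Cons i js)
    obtain g where g: "P g" "\<And>x. ((\<lambda>t. pderivs js f (x + t *\<^sub>R axis i 1)) has_vector_derivative g x) (at 0)"
      using deriv[OF Cons] by blast
    have "pderivs (i # js) f = g" by (auto simp: pderiv_fn_def vector_derivative_at[OF g(2)])
    then show ?case using g by simp
  qed
  then show ?thesis unfolding smooth_fn_def
    using cont deriv by (meson differentiableI_vector)
qed

lemma smooth_fn_continuous: "smooth_fn f \<Longrightarrow> continuous_on UNIV f"
  unfolding smooth_fn_def by (metis pderivs.simps(1))

lemma smooth_fn_has_pderiv:
  "smooth_fn f \<Longrightarrow> ((\<lambda>t. f (x + t *\<^sub>R axis i 1)) has_vector_derivative pderiv_fn i f x) (at 0)"
  unfolding smooth_fn_def pderiv_fn_def by (metis pderivs.simps(1) vector_derivative_works)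

lemma smooth_fn_pderiv: "smooth_fn f \<Longrightarrow> smooth_fn (pderiv_fn i f)"
  unfolding smooth_fn_def by (metis pderivs_snoc)

lemma smooth_fn_pderivs: "smooth_fn f \<Longrightarrow> smooth_fn (pderivs js f)"
  by (induction js) (auto intro: smooth_fn_pderiv)

lemma pderiv_fn_eqI:
  assumes "\<And>x. ((\<lambda>t. f (x + t *\<^sub>R axis i 1)) has_vector_derivative g x) (at 0)"
  shows "pderiv_fn i f = g"
  by (rule ext) (simp add: pderiv_fn_def vector_derivative_at[OF assms])

lemma has_pderiv_lincomb:
  assumes "\<And>k. k \<in> I \<Longrightarrow> smooth_fn (g k)"
  shows "((\<lambda>t. \<Sum>k\<in>I. c k * g k (x + t *\<^sub>R axis i 1)) has_vector_derivative
    (\<Sum>k\<in>I. c k * pderiv_fn i (g k) x)) (at 0)"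
  using assms by (intro has_vector_derivative_sum has_vector_derivative_mult_right smooth_fn_has_pderiv)

lemma smooth_fn_lincomb:
  assumes "\<And>k. k \<in> I \<Longrightarrow> smooth_fn (g k)"
  shows "smooth_fn (\<lambda>x. \<Sum>k\<in>I. c k * g k x)"
proof (rule smooth_fn_coinduct[where P = "\<lambda>f. \<exists>g. (\<forall>k\<in>I. smooth_fn (g k)) \<and> f = (\<lambda>x. \<Sum>k\<in>I. c k * g k x)"], goal_cases)
  case 1
  show ?case using assms by blast
next
  case (2 f)
  then show ?case by (auto intro!: continuous_intros intro: smooth_fn_continuous)
next
  case (3 f i)
  then obtain g where g: "\<And>k. k \<in> I \<Longrightarrow> smooth_fn (g k)" "f = (\<lambda>x. \<Sum>k\<in>I. c k * g k x)" by blast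
  show ?case
    using g has_pderiv_lincomb[of I g c _ i, OF g(1)]
    by (intro exI[of _ "\<lambda>x. \<Sum>k\<in>I. c k * pderiv_fn i (g k) x"] conjI exI[of _ "\<lambda>k. pderiv_fn i (g k)"])
       (auto intro: smooth_fn_pderiv)
qed

lemma pderivs_lincomb:
  assumes "\<And>k. k \<in> I \<Longrightarrow> smooth_fn (g k)"
  shows "pderivs js (\<lambda>x. \<Sum>k\<in>I. c k * g k x) = (\<lambda>x. \<Sum>k\<in>I. c k * pderivs js (g k) x)"
proof (induction js)
  case Nil
  show ?case by simp
next
  case (Cons i js)
  show ?case
    using assms unfolding pderivs.simps Cons
    by (intro pderiv_fn_eqI has_pderiv_lincomb smooth_fn_pderivs)
qed

text \<open>The Leibniz rule turns one product into a sum of two, so the invariant class for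
  coinduction has to contain sums of products.\<close>

inductive smooth_products :: "((real^'n) \<Rightarrow> complex) \<Rightarrow> bool" where
  mult: "smooth_fn f \<Longrightarrow> smooth_fn g \<Longrightarrow> smooth_products (\<lambda>x. f x * g x)"
| add: "smooth_products f \<Longrightarrow> smooth_products g \<Longrightarrow> smooth_products (\<lambda>x. f x + g x)"

lemma smooth_fn_mult:
  assumes "smooth_fn f" "smooth_fn g"
  shows "smooth_fn (\<lambda>x. f x * g x)"
proof (rule smooth_fn_coinduct[where P = smooth_products], goal_cases)
  case 1
  show ?case using assms by (rule smooth_products.mult)
next
  case (2 f)
  then show ?case by induction (auto intro!: continuous_intros intro: smooth_fn_continuous)
next
  case (3 f i)
  then show ?case
  proof induction
    case (mult f g)
    show ?case
    proof (intro exI conjI allI)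
      show "smooth_products (\<lambda>x. f x * pderiv_fn i g x + pderiv_fn i f x * g x)"
        using mult by (intro smooth_products.intros smooth_fn_pderiv)
      show "((\<lambda>t. f (x + t *\<^sub>R axis i 1) * g (x + t *\<^sub>R axis i 1)) has_vector_derivative
        f x * pderiv_fn i g x + pderiv_fn i f x * g x) (at 0)" for x
        using has_vector_derivative_mult[OF smooth_fn_has_pderiv[OF mult(1)] smooth_fn_has_pderiv[OF mult(2)], of x i x i]
        by simp
    qed
  next
    case (add f g)
    then obtain f' g' where "smooth_products f'" "smooth_products g'"
      "\<And>x. ((\<lambda>t. f (x + t *\<^sub>R axis i 1)) has_vector_derivative f' x) (at 0)"
      "\<And>x. ((\<lambda>t. g (x + t *\<^sub>R axis i 1)) has_vector_derivative g' x) (at 0)" by blast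
    then show ?case
      by (intro exI[of _ "\<lambda>x. f' x + g' x"] conjI allI smooth_products.add has_vector_derivative_add)
  qed
qed

lemma smooth_fn_const: "smooth_fn (\<lambda>x. c)"
  by (rule smooth_fn_coinduct[where P = "\<lambda>f. \<exists>c. f = (\<lambda>x. c)"])
     (auto intro!: exI[of _ "\<lambda>_. 0"])

lemma smooth_fn_add: "smooth_fn f \<Longrightarrow> smooth_fn g \<Longrightarrow> smooth_fn (\<lambda>x. f x + g x)"
  using smooth_fn_lincomb[of "UNIV :: bool set" "\<lambda>b. if b then f else g" "\<lambda>_. 1"] by (auto simp: UNIV_bool add.commute)

lemma smooth_fn_cnj:
  assumes "smooth_fn f"
  shows "smooth_fn (\<lambda>x. cnj (f x))"
proof (rule smooth_fn_coinduct[where P = "\<lambda>g. \<exists>f. smooth_fn f \<and> g = (\<lambda>x. cnj (f x))"], goal_cases)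
  case 1
  show ?case using assms by blast
next
  case (2 f)
  then show ?case by (auto intro!: continuous_intros intro: smooth_fn_continuous)
next
  case (3 f i)
  then obtain g where g: "smooth_fn g" "f = (\<lambda>x. cnj (g x))" by blast
  have "((\<lambda>t. f (x + t *\<^sub>R axis i 1)) has_vector_derivative cnj (pderiv_fn i g x)) (at 0)" for x
    unfolding g(2) by (intro bounded_linear.has_vector_derivative[OF bounded_linear_cnj] smooth_fn_has_pderiv g)
  then show ?case using smooth_fn_pderiv[OF g(1)] by blast
qed

lemma has_pderiv_translate:
  assumes "smooth_fn f"
  shows "((\<lambda>t. f (x + t *\<^sub>R axis i 1 - y)) has_vector_derivative pderiv_fn i f (x - y)) (at 0)"
  using smooth_fn_has_pderiv[OF assms, of "x - y" i] by (simp add: algebra_simps)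

lemma smooth_fn_translate:
  assumes "smooth_fn f"
  shows "smooth_fn (\<lambda>x. f (x - y))"
proof (rule smooth_fn_coinduct[where P = "\<lambda>g. \<exists>f. smooth_fn f \<and> g = (\<lambda>x. f (x - y))"], goal_cases)
  case 1
  show ?case using assms by blast
next
  case (2 f)
  then show ?case
    by (auto intro!: continuous_intros continuous_on_compose2[OF smooth_fn_continuous])
next
  case (3 f i)
  then obtain g where g: "smooth_fn g" "f = (\<lambda>x. g (x - y))" by blast
  then show ?case using has_pderiv_translate[OF g(1)] smooth_fn_pderiv[OF g(1)] by blast
qed

lemma pderivs_translate:
  assumes "smooth_fn f"
  shows "pderivs js (\<lambda>x. f (x - y)) = (\<lambda>x. pderivs js f (x - y))"
proof (induction js)
  case Nil
  show ?case by simp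
next
  case (Cons i js)
  show ?case unfolding pderivs.simps Cons
    by (intro pderiv_fn_eqI has_pderiv_translate smooth_fn_pderivs assms)
qed

lemma smooth_fn_expo_poly:
  fixes e :: "(real^'n) \<Rightarrow> complex"
  assumes "expo_poly e"
  shows "smooth_fn e"
proof -
  have coord: "smooth_fn (\<lambda>x::real^'n. complex_of_real (x $ j))" for j
  proof (rule smooth_fn_coinduct[where P = "\<lambda>f. f = (\<lambda>x. of_real (x $ j)) \<or> (\<exists>c. f = (\<lambda>x. c))"], goal_cases)
    case (2 f)
    then show ?case by (auto intro!: continuous_intros)
  next
    case (3 f i)
    have c: "((\<lambda>t. complex_of_real ((x + t *\<^sub>R axis i 1) $ j)) has_vector_derivative of_real (axis i 1 $ j)) (at 0)" for x :: "real^'n"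
    proof -
      have "((\<lambda>z. of_real (x $ j) + z * of_real (axis i 1 $ j)) has_field_derivative of_real (axis i 1 $ j)) (at (of_real 0 :: complex))"
        by (auto intro!: derivative_eq_intros)
      from has_vector_derivative_real_field[OF this] show ?thesis by simp
    qed
    from 3 show ?case
    proof (elim disjE exE)
      assume "f = (\<lambda>x. of_real (x $ j))"
      then show ?thesis using c by (intro exI[of _ "\<lambda>_. of_real (axis i 1 $ j)"]) auto
    next
      fix c assume "f = (\<lambda>x. c)"
      then show ?thesis by (intro exI[of _ "\<lambda>_. 0"]) auto
    qed
  qed simp
  have power: "smooth_fn (\<lambda>x::real^'n. complex_of_real (x $ j) ^ k)" for j k
    by (induction k) (auto intro: smooth_fn_const smooth_fn_mult coord)
  have mono: "smooth_fn (monomial_fn \<alpha> :: (real^'n) \<Rightarrow> complex)" for \<alpha>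
  proof -
    have "smooth_fn (\<lambda>x::real^'n. \<Prod>i\<in>J. complex_of_real (x $ i) ^ \<alpha> i)" if "finite J" for J
      using that by induction (auto intro: smooth_fn_const smooth_fn_mult power)
    from this[of UNIV] show ?thesis by (simp add: monomial_fn_def[abs_def])
  qed
  have expo: "smooth_fn (\<lambda>x::real^'n. exp (cinner l x))" for l
  proof (rule smooth_fn_coinduct[where P = "\<lambda>f. \<exists>c. f = (\<lambda>x. c * exp (cinner l x))"], goal_cases)
    case 1
    show ?case by (rule exI[of _ 1]) simp
  next
    case (2 f)
    then show ?case by (auto simp: cinner_def intro!: continuous_intros)
  next
    case (3 f i)
    then obtain c where f: "f = (\<lambda>x. c * exp (cinner l x))" by blast
    have lin: "cinner l (x + t *\<^sub>R axis i 1) = cinner l x + of_real t * l $ i" for x t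
      by (simp add: cinner_def axis_def algebra_simps sum.distrib if_distrib[of complex_of_real] if_distrib[of "(*) _"] sum.delta cong: if_cong)
    have "((\<lambda>t. f (x + t *\<^sub>R axis i 1)) has_vector_derivative (c * l $ i) * exp (cinner l x)) (at 0)" for x
    proof -
      have "((\<lambda>z. c * exp (cinner l x + z * l $ i)) has_field_derivative (c * l $ i) * exp (cinner l x)) (at (of_real 0))"
        by (auto intro!: derivative_eq_intros)
      from has_vector_derivative_real_field[OF this] show ?thesis by (simp add: f lin)
    qed
    then show ?case by (intro exI[of _ "\<lambda>x. (c * l $ i) * exp (cinner l x)"] conjI exI[of _ "c * l $ i"] refl allI)
  qed
  show ?thesis using assms unfolding expo_poly_iff_span
  proof (induction rule: fs.span_induct_alt)
    case base
    show ?case using smooth_fn_const[of 0] by (simp add: zero_fun_def)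
  next
    case (step c u v)
    then obtain \<alpha> l where u: "u = (\<lambda>x. monomial_fn \<alpha> x * exp (cinner l x))"
      by (auto simp: expo_basis_def)
    have "cscale c u + v = (\<lambda>x. c * u x + v x)" by (auto simp: cscale_apply)
    moreover have "smooth_fn (\<lambda>x. c * u x + v x)"
      unfolding u by (intro smooth_fn_add smooth_fn_mult smooth_fn_const mono expo step)
    ultimately show ?case by simp
  qed
qed

section \<open>Test functions, compact support and integrals\<close>

lemma test_fn_smooth: "test_fn \<phi> \<Longrightarrow> smooth_fn \<phi>"
  by (simp add: test_fn_def)

lemma test_fn_continuous: "test_fn \<phi> \<Longrightarrow> continuous_on UNIV \<phi>"
  by (intro smooth_fn_continuous test_fn_smooth)

lemma test_fn_support:
  assumes "test_fn \<phi>"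
  obtains R where "R > 0" "\<And>x. norm x > R \<Longrightarrow> \<phi> x = 0"
proof -
  obtain K where K: "compact K" "\<And>x. x \<notin> K \<Longrightarrow> \<phi> x = 0" using assms by (auto simp: test_fn_def)
  obtain R where "R > 0" "\<And>x. x \<in> K \<Longrightarrow> norm x \<le> R"
    using compact_imp_bounded[OF K(1)] by (auto simp: bounded_pos)
  then show ?thesis using K that[of R] by force
qed

lemma test_fnI:
  assumes "smooth_fn \<phi>" "\<And>x. norm x > R \<Longrightarrow> \<phi> x = 0"
  shows "test_fn \<phi>"
  unfolding test_fn_def using assms
  by (intro conjI exI[of _ "cball 0 R"]) auto

lemma test_fn_lincomb:
  assumes "finite I" "\<And>k. k \<in> I \<Longrightarrow> test_fn (g k)"
  shows "test_fn (\<lambda>x. \<Sum>k\<in>I. c k * g k x)"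
proof -
  have "\<exists>K. compact K \<and> (\<forall>x. x \<notin> K \<longrightarrow> (\<forall>k\<in>I. g k x = 0))"
  proof -
    have "\<forall>k\<in>I. \<exists>K. compact K \<and> (\<forall>x. x \<notin> K \<longrightarrow> g k x = 0)" using assms by (auto simp: test_fn_def)
    then obtain K where "\<And>k. k \<in> I \<Longrightarrow> compact (K k) \<and> (\<forall>x. x \<notin> K k \<longrightarrow> g k x = 0)" by metis
    then show ?thesis using assms(1) by (intro exI[of _ "\<Union>k\<in>I. K k"]) auto
  qed
  then obtain K where "compact K" "\<And>x k. x \<notin> K \<Longrightarrow> k \<in> I \<Longrightarrow> g k x = 0" by blast
  moreover have "smooth_fn (\<lambda>x. \<Sum>k\<in>I. c k * g k x)"
    using assms(2) by (intro smooth_fn_lincomb test_fn_smooth)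
  ultimately show ?thesis unfolding test_fn_def by (intro conjI exI[of _ K]) auto
qed

lemma test_fn_mult:
  assumes "test_fn \<phi>" "smooth_fn g"
  shows "test_fn (\<lambda>x. \<phi> x * g x)"
  using assms by (auto simp: test_fn_def intro: smooth_fn_mult)

lemma test_fn_translate:
  assumes "test_fn \<phi>"
  shows "test_fn (\<lambda>x. \<phi> (x - y))"
proof -
  obtain R where R: "\<And>x. norm x > R \<Longrightarrow> \<phi> x = 0" using test_fn_support[OF assms] by metis
  show ?thesis
  proof (rule test_fnI)
    show "smooth_fn (\<lambda>x. \<phi> (x - y))" using assms by (intro smooth_fn_translate test_fn_smooth)
    show "\<phi> (x - y) = 0" if "norm x > R + norm y" for x
      using that norm_triangle_ineq2[of x y] by (intro R) auto
  qed
qed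

text \<open>The region beyond radius \<open>R\<close> is open, so near each of its points the
  function is constantly 0 and every further derivative vanishes as well.\<close>

lemma pderivs_support:
  assumes "\<And>x. norm x > R \<Longrightarrow> \<phi> x = 0" "norm x > R"
  shows "pderivs js \<phi> x = 0"
  using assms(2)
proof (induction js arbitrary: x)
  case Nil
  then show ?case using assms by simp
next
  case (Cons i js)
  have "((\<lambda>t. pderivs js \<phi> (x + t *\<^sub>R axis i 1)) has_vector_derivative 0) (at 0)"
  proof (rule has_vector_derivative_transform_within_open[of "\<lambda>_. 0"])
    show "open {t. R < norm (x + t *\<^sub>R axis i 1)}"
      by (intro open_Collect_less continuous_intros)
  qed (use Cons in auto)
  then show ?case by (auto simp: pderiv_fn_def intro: vector_derivative_at)
qed

lemma continuous_compact_support_uniform: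
  fixes f :: "'a::euclidean_space \<Rightarrow> complex"
  assumes cont: "continuous_on UNIV f" and R: "\<And>x. norm x > R \<Longrightarrow> f x = 0" and "\<epsilon> > 0"
  shows "\<exists>\<delta>>0. \<forall>x y. dist x y < \<delta> \<longrightarrow> norm (f x - f y) < \<epsilon>"
proof -
  \<comment> \<open>The margin 1 matches \<open>min d 1\<close> below: if one of two close points
    has norm at most \<open>R\<close>, both lie in the larger ball; otherwise \<open>f\<close> is 0
    at both.\<close>
  have "uniformly_continuous_on (cball 0 (R + 1)) f"
    using continuous_on_subset[OF cont] by (intro compact_uniformly_continuous) auto
  then obtain d where d: "d > 0" "\<And>x y. x \<in> cball 0 (R + 1) \<Longrightarrow> y \<in> cball 0 (R + 1) \<Longrightarrow> dist x y < d \<Longrightarrow> norm (f x - f y) < \<epsilon>"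
    using \<open>\<epsilon> > 0\<close> unfolding uniformly_continuous_on_def dist_norm by (metis norm_minus_commute)
  have "norm (f x - f y) < \<epsilon>" if xy: "dist x y < min d 1" for x y
  proof (cases "norm x \<le> R \<or> norm y \<le> R")
    case True
    have "\<bar>norm x - norm y\<bar> < 1" using xy norm_triangle_ineq3[of x y] by (simp add: dist_norm)
    then show ?thesis using True xy by (intro d) auto
  next
    case False
    then show ?thesis using R \<open>\<epsilon> > 0\<close> by simp
  qed
  then show ?thesis using d by (intro exI[of _ "min d 1"]) auto
qed

lemma continuous_compact_support_bounded:
  fixes f :: "'a::euclidean_space \<Rightarrow> complex"
  assumes cont: "continuous_on UNIV f" and R: "\<And>x. norm x > R \<Longrightarrow> f x = 0"
  shows "\<exists>M>0. \<forall>x. norm (f x) \<le> M"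
proof -
  have "compact (f ` cball 0 R)"
    using continuous_on_subset[OF cont] by (intro compact_continuous_image) auto
  then obtain M where M: "M > 0" "\<And>x. x \<in> cball 0 R \<Longrightarrow> norm (f x) \<le> M"
    using compact_imp_bounded[of "f ` cball 0 R"] unfolding bounded_pos by blast
  have "norm (f x) \<le> M" for x
    using M R[of x] by (cases "norm x \<le> R") auto
  then show ?thesis using M by blast
qed

text \<open>Bridge from the Lebesgue integral to the gauge integral over a box, where Riemann sums
  and differentiation under the integral sign are carried out.\<close>

lemma compact_support_lborel_integral:
  fixes f :: "'a::euclidean_space \<Rightarrow> complex"
  assumes cont: "continuous_on UNIV f" and R: "\<And>x. x \<notin> cbox a b \<Longrightarrow> f x = 0"
  shows "integrable lborel f" "(f has_integral integral\<^sup>L lborel f) (cbox a b)"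
proof -
  have "integrable lborel (\<lambda>x. indicator (cbox a b) x *\<^sub>R f x)"
    using continuous_on_subset[OF cont] by (intro borel_integrable_compact) auto
  moreover have "(\<lambda>x. indicator (cbox a b) x *\<^sub>R f x) = f"
    using R by (auto simp: indicator_def)
  ultimately show int: "integrable lborel f" by simp
  have "(\<lambda>x. if x \<in> cbox a b then f x else 0) = f" using R by auto
  then have "((\<lambda>x. if x \<in> cbox a b then f x else 0) has_integral integral\<^sup>L lborel f) UNIV"
    using has_integral_integral_lborel[OF int] by (simp only:)
  then show "(f has_integral integral\<^sup>L lborel f) (cbox a b)"
    by (simp only: has_integral_restrict_UNIV)
qed

lemma norm_bound_cbox:
  obtains a b :: "real^'n" where "\<And>x. norm x \<le> R \<Longrightarrow> x \<in> cbox a b"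
proof -
  obtain a :: "real^'n" where "cball 0 R \<subseteq> cbox (-a) a"
    using bounded_subset_cbox_symmetric bounded_cball by blast
  then show ?thesis using that[of "-a" a] by (meson mem_cball_0 subsetD)
qed

lemma test_fn_cbox:
  fixes \<phi> :: "(real^'n) \<Rightarrow> complex"
  assumes "test_fn \<phi>"
  obtains a b where "\<And>x. x \<notin> cbox a b \<Longrightarrow> \<phi> x = 0"
proof -
  obtain R where R: "\<And>x. norm x > R \<Longrightarrow> \<phi> x = 0" using test_fn_support[OF assms] by metis
  obtain a b :: "real^'n" where "\<And>x. norm x \<le> R \<Longrightarrow> x \<in> cbox a b" using norm_bound_cbox[of R] by blast
  then show ?thesis using R that[of a b] by (meson not_le)
qed

lemma integrable_mult_test_fn:
  assumes "continuous_on UNIV g" "test_fn \<phi>"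
  shows "integrable lborel (\<lambda>x. g x * \<phi> x)"
proof -
  obtain a b where ab: "\<And>x. x \<notin> cbox a b \<Longrightarrow> \<phi> x = 0" using test_fn_cbox[OF assms(2)] by metis
  have "continuous_on UNIV (\<lambda>x. g x * \<phi> x)"
    using assms(1) test_fn_continuous[OF assms(2)] by (intro continuous_intros)
  then show ?thesis by (rule compact_support_lborel_integral(1)[of _ a b]) (simp add: ab)
qed

lemma lborel_integral_translate:
  fixes f :: "'a::euclidean_space \<Rightarrow> complex"
  assumes "continuous_on UNIV f"
  shows "integral\<^sup>L lborel (\<lambda>x. f (y + x)) = integral\<^sup>L lborel f"
proof -
  have [measurable]: "f \<in> borel_measurable borel" using assms by (rule borel_measurable_continuous_onI)
  have "integral\<^sup>L lborel f = integral\<^sup>L (distr lborel borel ((+) y)) f" by (simp add: lborel_distr_plus)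
  also have "\<dots> = integral\<^sup>L lborel (\<lambda>x. f (y + x))" by (subst integral_distr) auto
  finally show ?thesis by simp
qed

lemma lborel_integral_reflect:
  fixes f :: "'a::euclidean_space \<Rightarrow> complex"
  assumes "continuous_on UNIV f"
  shows "integral\<^sup>L lborel (\<lambda>x. f (y - x)) = integral\<^sup>L lborel f"
proof -
  have [measurable]: "f \<in> borel_measurable borel" using assms by (rule borel_measurable_continuous_onI)
  have "(lborel :: 'a measure) = distr lborel borel (\<lambda>x. y - x)"
    using lborel_affine[of "-1" y] by (simp add: density_1)
  then have "integral\<^sup>L lborel f = integral\<^sup>L (distr lborel borel (\<lambda>x. y - x)) f" by simp
  also have "\<dots> = integral\<^sup>L lborel (\<lambda>x. f (y - x))" by (subst integral_distr) auto
  finally show ?thesis by simp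
qed

text \<open>Testing \<open>e\<close> against its conjugate, weighted by the squared modulus of a
  test function, makes the integrand continuous and nonnegative, so a zero integral forces it to
  vanish. \<open>\<rho>\<close> provides the weight.\<close>

lemma smooth_fn_zero_of_test_integrals:
  fixes e \<rho> :: "(real^'n) \<Rightarrow> complex"
  assumes e: "smooth_fn e" and \<rho>: "test_fn \<rho>" "\<rho> w \<noteq> 0"
    and zero: "\<And>\<psi>. test_fn \<psi> \<Longrightarrow> integral\<^sup>L lborel (\<lambda>x. e x * \<psi> x) = 0"
  shows "e z = 0"
proof -
  \<comment> \<open>The translation takes \<open>w\<close> to \<open>z\<close>, so the weight is
    nonzero at \<open>z\<close>.\<close>
  define \<xi> where "\<xi> = (\<lambda>x. \<rho> (x - (z - w)))"
  define \<psi> where "\<psi> = (\<lambda>x. \<xi> x * (cnj (\<xi> x) * cnj (e x)))"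
  have \<xi>: "test_fn \<xi>" unfolding \<xi>_def using \<rho>(1) by (rule test_fn_translate)
  have \<psi>: "test_fn \<psi>" unfolding \<psi>_def
    using \<xi> by (intro test_fn_mult smooth_fn_mult smooth_fn_cnj e test_fn_smooth)
  obtain R where R: "\<And>x. norm x > R \<Longrightarrow> \<psi> x = 0" using test_fn_support[OF \<psi>] by metis
  \<comment> \<open>The radius \<open>norm z + 1\<close> puts \<open>z\<close> into the interior of
    the box. The box is then not degenerate, as is required to pass from a zero integral to
    pointwise vanishing.\<close>
  obtain a b :: "real^'n" where ab: "\<And>x. norm x \<le> max R (norm z + 1) \<Longrightarrow> x \<in> cbox a b"
    using norm_bound_cbox[of "max R (norm z + 1)"] by blast
  have box: "\<psi> x = 0" if "x \<notin> cbox a b" for x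
    using ab[of x] R[of x] that by fastforce
  have "norm x \<le> norm z + 1" if "x \<in> ball z 1" for x
    using that norm_triangle_ineq2[of x z] by (simp add: dist_norm norm_minus_commute)
  then have "ball z 1 \<subseteq> cbox a b" using ab by (metis max.cobounded2 order_trans subsetI)
  then have inner: "z \<in> box a b"
    using interior_maximal[of "ball z 1" "cbox a b"] by (auto simp: interior_cbox)
  define r where "r = (\<lambda>x. (norm (\<xi> x))\<^sup>2 * (norm (e x))\<^sup>2)"
  have prod: "e x * \<psi> x = of_real (r x)" for x
    unfolding r_def \<psi>_def of_real_mult complex_norm_square by (simp only: mult_ac)
  have "continuous_on UNIV (\<lambda>x. e x * \<psi> x)"
    using smooth_fn_continuous[OF e] test_fn_continuous[OF \<psi>] by (intro continuous_intros)
  then have "((\<lambda>x. e x * \<psi> x) has_integral 0) (cbox a b)"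
    using compact_support_lborel_integral(2)[of "\<lambda>x. e x * \<psi> x" a b] box zero[OF \<psi>] by simp
  from has_integral_Re[OF this] have "(r has_integral 0) (cbox a b)" by (simp add: prod)
  moreover have "continuous_on (cbox a b) r" unfolding r_def
    using continuous_on_subset[OF smooth_fn_continuous[OF e]] continuous_on_subset[OF test_fn_continuous[OF \<xi>]]
    by (intro continuous_intros) auto
  ultimately have "r z = 0"
    using inner box_subset_cbox[of a b]
    by (intro has_integral_0_cbox_imp_0[of a b r]) (auto simp: r_def)
  moreover have "\<xi> z \<noteq> 0" using \<rho>(2) by (simp add: \<xi>_def)
  ultimately show ?thesis by (simp add: r_def)
qed

section \<open>Distributions and convolution\<close>

text \<open>On each cell the summand differs from the integral by the integral of
  \<open>g y - g z\<close> over \<open>z\<close>, which is at most \<open>\<epsilon>\<close> times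
  the volume of the cell.\<close>

lemma riemann_sum_bound:
  fixes g :: "'a::euclidean_space \<Rightarrow> complex"
  assumes g: "continuous_on (cbox a b) g" and p: "p tagged_division_of cbox a b" and "0 \<le> \<epsilon>"
    and osc: "\<And>y K z. (y, K) \<in> p \<Longrightarrow> z \<in> K \<Longrightarrow> norm (g y - g z) \<le> \<epsilon>"
  shows "norm ((\<Sum>(y, K)\<in>p. of_real (measure lborel K) * g y) - integral (cbox a b) g) \<le> \<epsilon> * measure lborel (cbox a b)"
proof -
  have int: "g integrable_on cbox a b" using g by (rule integrable_continuous)
  have "(\<Sum>(y, K)\<in>p. of_real (measure lborel K) * g y) - integral (cbox a b) g
      = (\<Sum>(y, K)\<in>p. of_real (measure lborel K) * g y - integral K g)"
    unfolding integral_combine_tagged_division_topdown[OF int p]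
    by (simp add: sum_subtractf split_def)
  also have "norm \<dots> \<le> (\<Sum>(y, K)\<in>p. \<epsilon> * measure lborel K)"
  proof (rule sum_norm_le, clarify)
    fix y K assume yK: "(y, K) \<in> p"
    obtain u v where K: "K = cbox u v" using tagged_division_ofD(4)[OF p yK] by blast
    have sub: "K \<subseteq> cbox a b" using tagged_division_ofD(3)[OF p yK] .
    have "g integrable_on K" unfolding K
      by (rule integrable_continuous) (use g sub K continuous_on_subset in blast)
    then have "((\<lambda>z. g y - g z) has_integral measure lborel K *\<^sub>R g y - integral K g) (cbox u v)"
      unfolding K by (intro has_integral_diff has_integral_const integrable_integral)
    from has_integral_bound[OF \<open>0 \<le> \<epsilon>\<close> this]
    show "norm (of_real (measure lborel K) * g y - integral K g) \<le> \<epsilon> * measure lborel K"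
      using osc[OF yK] by (simp add: K scaleR_conv_of_real)
  qed
  also have "\<dots> = \<epsilon> * measure lborel (cbox a b)"
    using additive_content_tagged_division[OF p] by (simp add: sum_distrib_left[symmetric] split_def)
  finally show ?thesis .
qed

lemma test_fn_lincomb2:
  assumes "test_fn f" "test_fn g"
  shows "test_fn (\<lambda>x. a * f x + b * g x)"
  using test_fn_lincomb[of "UNIV :: bool set" "\<lambda>k. if k then f else g" "\<lambda>k. if k then a else b"] assms
  by (auto simp: UNIV_bool add.commute)

lemma pderivs_lincomb2:
  assumes "smooth_fn f" "smooth_fn g"
  shows "pderivs js (\<lambda>x. a * f x + b * g x) = (\<lambda>x. a * pderivs js f x + b * pderivs js g x)"
  using pderivs_lincomb[of "UNIV :: bool set" "\<lambda>k. if k then f else g" js "\<lambda>k. if k then a else b"] assms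
  by (auto simp: UNIV_bool add.commute)

lemma distribution_linear:
  "distribution T \<Longrightarrow> test_fn \<phi> \<Longrightarrow> test_fn \<psi> \<Longrightarrow> T (\<lambda>x. a * \<phi> x + b * \<psi> x) = a * T \<phi> + b * T \<psi>"
  unfolding distribution_def by blast

lemma distribution_lincomb:
  assumes T: "distribution T" and "finite I" "\<And>k. k \<in> I \<Longrightarrow> test_fn (g k)"
  shows "T (\<lambda>x. \<Sum>k\<in>I. c k * g k x) = (\<Sum>k\<in>I. c k * T (g k))"
  using assms(2,3)
proof (induction I)
  case empty
  have "test_fn (\<lambda>x::real^'a. 0)" by (rule test_fnI[OF smooth_fn_const]) simp
  from distribution_linear[OF T this this, of 0 0] show ?case by simp
next
  case (insert k I)
  have "test_fn (\<lambda>x. \<Sum>k\<in>I. c k * g k x)" using insert by (intro test_fn_lincomb) auto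
  from distribution_linear[OF T _ this, of "g k" "c k" 1] insert show ?case by simp
qed

text \<open>Sequential continuity is stated at 0, so it is applied to the differences; the common
  radius \<open>R\<close> supplies the compact set.\<close>

lemma distribution_tendsto:
  fixes \<phi> :: "nat \<Rightarrow> (real^'n) \<Rightarrow> complex"
  assumes T: "distribution T" and test: "\<And>j. test_fn (\<phi> j)" "test_fn \<psi>"
    and supp: "\<And>j x. norm x > R \<Longrightarrow> \<phi> j x = 0" "\<And>x. norm x > R \<Longrightarrow> \<psi> x = 0"
    and conv: "\<And>js \<epsilon>. \<epsilon> > 0 \<Longrightarrow> eventually (\<lambda>j. \<forall>x. norm (pderivs js (\<phi> j) x - pderivs js \<psi> x) < \<epsilon>) sequentially"
  shows "(\<lambda>j. T (\<phi> j)) \<longlonglongrightarrow> T \<psi>"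
proof -
  define \<eta> where "\<eta> = (\<lambda>j x. 1 * \<phi> j x + (-1) * \<psi> x)"
  have \<eta>: "test_fn (\<eta> j)" for j unfolding \<eta>_def using test by (intro test_fn_lincomb2)
  have d: "pderivs js (\<eta> j) x = pderivs js (\<phi> j) x - pderivs js \<psi> x" for js j x
    unfolding \<eta>_def by (subst pderivs_lincomb2) (use test in \<open>auto intro: test_fn_smooth\<close>)
  have "(\<lambda>j. T (\<eta> j)) \<longlonglongrightarrow> 0"
  proof -
    have "compact (cball (0::real^'n) R) \<and> (\<forall>j. test_fn (\<eta> j) \<and> (\<forall>x. x \<notin> cball 0 R \<longrightarrow> \<eta> j x = 0)) \<and>
      (\<forall>js. \<forall>\<epsilon>>0. eventually (\<lambda>j. \<forall>x. norm (pderivs js (\<eta> j) x) < \<epsilon>) sequentially)"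
      using \<eta> supp conv unfolding d by (auto simp: \<eta>_def)
    then show ?thesis using T unfolding distribution_def by blast
  qed
  moreover have "T (\<eta> j) = T (\<phi> j) - T \<psi>" for j
    using distribution_linear[OF T test(1)[of j] test(2), of 1 "-1"] by (simp add: \<eta>_def)
  ultimately show ?thesis by (simp add: LIM_zero_cancel)
qed

text \<open>Every derivative of \<open>\<phi>\<close> is uniformly continuous, so translates along a
  convergent sequence converge uniformly with all derivatives. Boundedness of the sequence confines
  them to one ball of radius \<open>R + M\<close>.\<close>

lemma distribution_translate_continuous:
  fixes \<phi> :: "(real^'n) \<Rightarrow> complex"
  assumes T: "distribution T" and \<phi>: "test_fn \<phi>"
  shows "continuous_on UNIV (\<lambda>y. T (\<lambda>x. \<phi> (x - y)))"
  unfolding continuous_on_sequentially o_def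
proof (intro allI ballI impI, elim conjE)
  fix y :: "nat \<Rightarrow> real^'n" and z assume y: "y \<longlonglongrightarrow> z"
  obtain R where R: "R > 0" "\<And>x. norm x > R \<Longrightarrow> \<phi> x = 0" using test_fn_support[OF \<phi>] by metis
  obtain M where M: "\<And>n. norm (y n) \<le> M"
    using convergent_imp_bounded[OF y] by (auto simp: bounded_iff)
  have zM: "norm z \<le> M" using y M by (intro LIMSEQ_le_const2[OF tendsto_norm[OF y]]) auto
  have far: "norm (x - v) > R" if "norm x > R + M" "norm v \<le> M" for x v :: "real^'n"
    using that norm_triangle_ineq2[of x v] by linarith
  show "(\<lambda>n. T (\<lambda>x. \<phi> (x - y n))) \<longlonglongrightarrow> T (\<lambda>x. \<phi> (x - z))"
  proof (rule distribution_tendsto[OF T, of _ _ "R + M"])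
    fix js and \<epsilon> :: real assume \<epsilon>: "\<epsilon> > 0"
    have sm: "smooth_fn \<phi>" using \<phi> by (rule test_fn_smooth)
    have c: "continuous_on UNIV (pderivs js \<phi>)" using sm by (intro smooth_fn_continuous smooth_fn_pderivs)
    have s: "pderivs js \<phi> x = 0" if "norm x > R" for x
      using R(2) that by (rule pderivs_support)
    obtain \<delta> where \<delta>: "\<delta> > 0" "\<And>x y. dist x y < \<delta> \<Longrightarrow> norm (pderivs js \<phi> x - pderivs js \<phi> y) < \<epsilon>"
      using continuous_compact_support_uniform[OF c s \<epsilon>] by blast
    have "eventually (\<lambda>n. dist (y n) z < \<delta>) sequentially" using y \<delta>(1) by (rule tendstoD)
    then show "eventually (\<lambda>n. \<forall>x. norm (pderivs js (\<lambda>x. \<phi> (x - y n)) x - pderivs js (\<lambda>x. \<phi> (x - z)) x) < \<epsilon>) sequentially"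
      by eventually_elim (auto simp: pderivs_translate[OF sm] dist_norm norm_minus_commute intro!: \<delta>(2))
  qed (use \<phi> R far M zM in \<open>auto intro: test_fn_translate\<close>)
qed

section \<open>Convolution and its evaluation by a distribution\<close>

definition convolution :: "((real^'n) \<Rightarrow> complex) \<Rightarrow> ((real^'n) \<Rightarrow> complex) \<Rightarrow> (real^'n) \<Rightarrow> complex" where
  "convolution \<phi> \<psi> x = integral\<^sup>L lborel (\<lambda>y. \<psi> y * \<phi> (x - y))"

lemma continuous_translate_integrand:
  assumes "continuous_on UNIV \<phi>" "continuous_on UNIV \<psi>"
  shows "continuous_on UNIV (\<lambda>y. \<psi> y * \<phi> (x - y :: real^'n) :: complex)"
  using assms(2) by (intro continuous_intros continuous_on_compose2[OF assms(1)]) auto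

lemma convolution_commute:
  assumes "continuous_on UNIV \<phi>" "continuous_on UNIV \<psi>"
  shows "convolution \<phi> \<psi> = convolution \<psi> \<phi>"
proof
  fix x
  show "convolution \<phi> \<psi> x = convolution \<psi> \<phi> x"
    using lborel_integral_reflect[OF continuous_translate_integrand[OF assms, of x], of x]
    by (simp add: convolution_def mult.commute)
qed

lemma convolution_cbox:
  assumes "continuous_on UNIV \<phi>" "continuous_on UNIV \<psi>" "\<And>y. y \<notin> cbox a b \<Longrightarrow> \<psi> y = 0"
  shows "convolution \<phi> \<psi> x = integral (cbox a b) (\<lambda>y. \<psi> y * \<phi> (x - y))"
  using compact_support_lborel_integral(2)[OF continuous_translate_integrand[OF assms(1,2)], of a b x] assms(3)
  by (auto simp: convolution_def intro: integral_unique[symmetric])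

text \<open>Smoothness is defined by derivatives at parameter 0; moving the base point gives them at
  every \<open>s\<close>, as differentiation under the integral sign demands.\<close>

lemma smooth_fn_has_pderiv_at:
  assumes "smooth_fn f"
  shows "((\<lambda>t. f (x + t *\<^sub>R axis i 1)) has_vector_derivative pderiv_fn i f (x + s *\<^sub>R axis i 1)) (at s)"
proof -
  have "((\<lambda>t. t - s) has_vector_derivative 1) (at s)" by (auto intro!: derivative_eq_intros)
  moreover have "((\<lambda>t. f ((x + s *\<^sub>R axis i 1) + t *\<^sub>R axis i 1)) has_vector_derivative pderiv_fn i f (x + s *\<^sub>R axis i 1)) (at (s - s))"
    using smooth_fn_has_pderiv[OF assms] by simp
  ultimately have "((\<lambda>t. f ((x + s *\<^sub>R axis i 1) + (t - s) *\<^sub>R axis i 1)) has_vector_derivative 1 *\<^sub>R pderiv_fn i f (x + s *\<^sub>R axis i 1)) (at s)"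
    using vector_diff_chain_at[of "\<lambda>t. t - s" 1 s "\<lambda>t. f ((x + s *\<^sub>R axis i 1) + t *\<^sub>R axis i 1)"] by (simp add: o_def)
  then show ?thesis by (simp add: algebra_simps)
qed

text \<open>The variable enters only through \<open>\<phi>\<close>, and the integral runs over a
  fixed box around the support of \<open>\<psi>\<close>, so the Leibniz integral rule
  applies.\<close>

lemma has_pderiv_convolution:
  assumes \<phi>: "smooth_fn \<phi>" and \<psi>: "test_fn \<psi>"
  shows "((\<lambda>t. convolution \<phi> \<psi> (x + t *\<^sub>R axis i 1)) has_vector_derivative convolution (pderiv_fn i \<phi>) \<psi> x) (at 0)"
proof -
  obtain a b where ab: "\<And>y. y \<notin> cbox a b \<Longrightarrow> \<psi> y = 0" using test_fn_cbox[OF \<psi>] by metis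
  note c\<psi> = test_fn_continuous[OF \<psi>] and c\<phi> = smooth_fn_continuous[OF \<phi>]
    and cd = smooth_fn_continuous[OF smooth_fn_pderiv[OF \<phi>, of i]]
  have "((\<lambda>t. integral (cbox a b) (\<lambda>y. \<psi> y * \<phi> (x + t *\<^sub>R axis i 1 - y))) has_vector_derivative
      integral (cbox a b) (\<lambda>y. \<psi> y * pderiv_fn i \<phi> (x + 0 *\<^sub>R axis i 1 - y))) (at 0 within UNIV)"
  proof (rule leibniz_rule_vector_derivative[where fx = "\<lambda>t y. \<psi> y * pderiv_fn i \<phi> (x + t *\<^sub>R axis i 1 - y)"])
    fix t y
    have "((\<lambda>t. \<phi> (x + t *\<^sub>R axis i 1 - y)) has_vector_derivative pderiv_fn i \<phi> (x + t *\<^sub>R axis i 1 - y)) (at t)"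
      using smooth_fn_has_pderiv_at[OF \<phi>, of "x - y" i t] by (simp add: algebra_simps)
    then show "((\<lambda>t. \<psi> y * \<phi> (x + t *\<^sub>R axis i 1 - y)) has_vector_derivative
        \<psi> y * pderiv_fn i \<phi> (x + t *\<^sub>R axis i 1 - y)) (at t within UNIV)"
      by (auto intro: has_vector_derivative_mult_right)
  next
    show "(\<lambda>y. \<psi> y * \<phi> (x + t *\<^sub>R axis i 1 - y)) integrable_on cbox a b" for t
      using continuous_translate_integrand[OF c\<phi> c\<psi>, of "x + t *\<^sub>R axis i 1"]
      by (intro integrable_continuous) (rule continuous_on_subset, auto)
    show "continuous_on (UNIV \<times> cbox a b) (\<lambda>(t, y). \<psi> y * pderiv_fn i \<phi> (x + t *\<^sub>R axis i 1 - y))"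
      unfolding split_def
      by (intro continuous_intros continuous_on_compose2[OF cd] continuous_on_compose2[OF c\<psi>]) auto
  qed auto
  then show ?thesis
    by (simp add: convolution_cbox[OF c\<phi> c\<psi> ab] convolution_cbox[OF cd c\<psi> ab])
qed

lemma pderivs_convolution:
  assumes "smooth_fn \<phi>" "test_fn \<psi>"
  shows "pderivs js (convolution \<phi> \<psi>) = convolution (pderivs js \<phi>) \<psi>"
proof (induction js)
  case (Cons i js)
  show ?case unfolding pderivs.simps Cons
    by (intro pderiv_fn_eqI has_pderiv_convolution smooth_fn_pderivs assms)
qed simp

lemma smooth_fn_convolution:
  assumes \<phi>: "smooth_fn \<phi>" and \<psi>: "test_fn \<psi>"
  shows "smooth_fn (convolution \<phi> \<psi>)"
proof (rule smooth_fn_coinduct[where P = "\<lambda>f. \<exists>\<phi>. smooth_fn \<phi> \<and> f = convolution \<phi> \<psi>"], goal_cases)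
  case 1
  show ?case using \<phi> by blast
next
  case (2 f)
  then obtain \<phi> where \<phi>: "smooth_fn \<phi>" "f = convolution \<phi> \<psi>" by blast
  obtain a b where ab: "\<And>y. y \<notin> cbox a b \<Longrightarrow> \<psi> y = 0" using test_fn_cbox[OF \<psi>] by metis
  note c\<psi> = test_fn_continuous[OF \<psi>] and c\<phi> = smooth_fn_continuous[OF \<phi>(1)]
  have "continuous_on UNIV (\<lambda>x. integral (cbox a b) (\<lambda>y. \<psi> y * \<phi> (x - y)))"
  proof (rule integral_continuous_on_param)
    show "continuous_on (UNIV \<times> cbox a b) (\<lambda>(x, y). \<psi> y * \<phi> (x - y))"
      unfolding split_def
      by (intro continuous_intros continuous_on_compose2[OF c\<phi>] continuous_on_compose2[OF c\<psi>]) auto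
  qed
  moreover have "f = (\<lambda>x. integral (cbox a b) (\<lambda>y. \<psi> y * \<phi> (x - y)))"
    unfolding \<phi>(2) by (rule ext, rule convolution_cbox[OF c\<phi> c\<psi>]) (rule ab)
  ultimately show ?case by simp
next
  case (3 f i)
  then show ?case using has_pderiv_convolution[OF _ \<psi>] smooth_fn_pderiv by blast
qed

lemma convolution_support:
  assumes "\<And>x. norm x > R \<Longrightarrow> \<phi> x = 0" "\<And>x. norm x > S \<Longrightarrow> \<psi> x = 0" "norm x > R + S"
  shows "convolution \<phi> \<psi> x = 0"
proof -
  have "\<psi> y * \<phi> (x - y) = 0" for y
    using assms(1)[of "x - y"] assms(2)[of y] assms(3) norm_triangle_ineq2[of x y]
    by (cases "norm y > S") auto
  then have "(\<lambda>y. \<psi> y * \<phi> (x - y)) = (\<lambda>y. 0)" by (rule ext)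
  then show ?thesis by (simp only: convolution_def integral_zero)
qed

text \<open>Riemann sums of the convolution integral are finite combinations of translates of
  \<open>\<phi>\<close>. They converge to the convolution in the sense of test functions, while
  \<open>T\<close> maps them to Riemann sums of the right-hand integral.\<close>

lemma distribution_convolution:
  fixes \<phi> \<psi> :: "(real^'n) \<Rightarrow> complex"
  assumes T: "distribution T" and \<phi>: "test_fn \<phi>" and \<psi>: "test_fn \<psi>"
  shows "T (convolution \<phi> \<psi>) = integral\<^sup>L lborel (\<lambda>y. \<psi> y * T (\<lambda>x. \<phi> (x - y)))"
proof -
  define f where "f = (\<lambda>y. T (\<lambda>x. \<phi> (x - y)))"
  have cf: "continuous_on UNIV f" unfolding f_def using T \<phi> by (rule distribution_translate_continuous)
  obtain R where R: "R > 0" "\<And>x. norm x > R \<Longrightarrow> \<phi> x = 0" using test_fn_support[OF \<phi>] by metis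
  obtain S where S: "S > 0" "\<And>x. norm x > S \<Longrightarrow> \<psi> x = 0" using test_fn_support[OF \<psi>] by metis
  obtain a b where ab: "\<And>y. y \<notin> cbox a b \<Longrightarrow> \<psi> y = 0" using test_fn_cbox[OF \<psi>] by metis
  note c\<psi> = test_fn_continuous[OF \<psi>] and sm = test_fn_smooth[OF \<phi>]
  \<comment> \<open>Balls of radius 1/(n+1) as gauges yield divisions with shrinking cells; one
    sequence of divisions serves all integrals below.\<close>
  have "\<exists>p. p tagged_division_of cbox a b \<and> (\<lambda>y. ball y (1 / real (Suc n))) fine p" for n
  proof -
    have "gauge (\<lambda>y::real^'n. ball y (1 / real (Suc n)))" by (rule gauge_ball) simp
    then show ?thesis by (rule fine_division_exists) blast
  qed
  then obtain p where p: "\<And>n. p n tagged_division_of cbox a b"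
      "\<And>n. (\<lambda>y. ball y (1 / real (Suc n))) fine p n" by metis
  have fin: "finite (p n)" for n using p(1) by (rule tagged_division_of_finite)
  have dist: "dist y z < 1 / real (Suc n)" if "(y, K) \<in> p n" "z \<in> K" for y z K n
    using fineD[OF p(2) that(1)] that(2) by auto
  define c where "c = (\<lambda>(y, K :: (real^'n) set). of_real (measure lborel K) * \<psi> y)"
  define r where "r = (\<lambda>n x. \<Sum>k\<in>p n. c k * \<phi> (x - fst k))"
  have r: "test_fn (r n)" for n
    unfolding r_def using fin by (intro test_fn_lincomb test_fn_translate \<phi>)
  have Tr: "T (r n) = (\<Sum>(y, K)\<in>p n. of_real (measure lborel K) * (\<psi> y * f y))" for n
  proof -
    have "T (r n) = (\<Sum>k\<in>p n. c k * T (\<lambda>x. \<phi> (x - fst k)))"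
      unfolding r_def using fin by (intro distribution_lincomb T test_fn_translate \<phi>)
    also have "\<dots> = (\<Sum>(y, K)\<in>p n. of_real (measure lborel K) * (\<psi> y * f y))"
      by (intro sum.cong) (auto simp: c_def f_def)
    finally show ?thesis .
  qed
  \<comment> \<open>Convergence of Riemann sums, uniform in a parameter \<open>x\<close>. It is used
    once for the values under \<open>T\<close>, with no dependence on \<open>x\<close>, and once for
    each derivative of the sums.\<close>
  have riemann: "eventually (\<lambda>n. \<forall>x. norm ((\<Sum>(y, K)\<in>p n. of_real (measure lborel K) * g x y) - integral (cbox a b) (g x)) < \<epsilon>) sequentially"
    if cont: "\<And>x. continuous_on (cbox a b) (g x)" and "\<epsilon> > 0"
      and unif: "\<And>\<epsilon>. \<epsilon> > 0 \<Longrightarrow> \<exists>\<delta>>0. \<forall>x. \<forall>y\<in>cbox a b. \<forall>z\<in>cbox a b. dist y z < \<delta> \<longrightarrow> norm (g x y - g x z) \<le> \<epsilon>"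
    for g :: "(real^'n) \<Rightarrow> (real^'n) \<Rightarrow> complex" and \<epsilon> :: real
  proof -
    \<comment> \<open>The summand 1 keeps the denominator positive for a box of volume 0 and makes
      the final estimate strict.\<close>
    define \<epsilon>' where "\<epsilon>' = \<epsilon> / (measure lborel (cbox a b) + 1)"
    have pos: "measure lborel (cbox a b) + 1 > 0" using content_nonneg by (simp add: add_nonneg_pos)
    then have \<epsilon>': "\<epsilon>' > 0" "\<epsilon>' * measure lborel (cbox a b) < \<epsilon>"
      using \<open>\<epsilon> > 0\<close> by (simp_all add: \<epsilon>'_def field_simps)
    obtain \<delta> where \<delta>: "\<delta> > 0" "\<And>x y z. y \<in> cbox a b \<Longrightarrow> z \<in> cbox a b \<Longrightarrow> dist y z < \<delta> \<Longrightarrow> norm (g x y - g x z) \<le> \<epsilon>'"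
      using unif[OF \<epsilon>'(1)] by blast
    have "eventually (\<lambda>n. 1 / real (Suc n) < \<delta>) sequentially"
      using \<delta>(1) by (intro order_tendstoD(2)[OF LIMSEQ_Suc[OF lim_1_over_n]])
    then show ?thesis
    proof eventually_elim
      case (elim n)
      show ?case
      proof
        fix x
        have "norm ((\<Sum>(y, K)\<in>p n. of_real (measure lborel K) * g x y) - integral (cbox a b) (g x)) \<le> \<epsilon>' * measure lborel (cbox a b)"
        proof (rule riemann_sum_bound[OF cont p(1)])
          fix y K z assume yK: "(y, K) \<in> p n" "z \<in> K"
          have "y \<in> cbox a b" "z \<in> cbox a b"
            using tagged_division_ofD(2,3)[OF p(1) yK(1)] yK(2) by auto
          then show "norm (g x y - g x z) \<le> \<epsilon>'" using dist[OF yK] elim by (intro \<delta>(2)) auto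
        qed (use \<epsilon>' in auto)
        then show "norm ((\<Sum>(y, K)\<in>p n. of_real (measure lborel K) * g x y) - integral (cbox a b) (g x)) < \<epsilon>"
          using \<epsilon>' by linarith
      qed
    qed
  qed
  have cpf: "continuous_on UNIV (\<lambda>y. \<psi> y * f y)" using c\<psi> cf by (intro continuous_intros)
  have "(\<lambda>n. T (r n)) \<longlonglongrightarrow> integral (cbox a b) (\<lambda>y. \<psi> y * f y)"
  proof (rule tendstoI)
    fix \<epsilon> :: real assume "\<epsilon> > 0"
    have cont: "continuous_on (cbox a b) (\<lambda>y. \<psi> y * f y)" using cpf by (rule continuous_on_subset) auto
    then have uc: "uniformly_continuous_on (cbox a b) (\<lambda>y. \<psi> y * f y)"
      by (intro compact_uniformly_continuous) auto
    have "eventually (\<lambda>n. \<forall>x::real^'n. norm ((\<Sum>(y, K)\<in>p n. of_real (measure lborel K) * (\<psi> y * f y))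
        - integral (cbox a b) (\<lambda>y. \<psi> y * f y)) < \<epsilon>) sequentially"
    proof (rule riemann[of "\<lambda>_ y. \<psi> y * f y", OF cont \<open>\<epsilon> > 0\<close>])
      fix \<epsilon> :: real assume "\<epsilon> > 0"
      then obtain d where "d > 0" "\<forall>y\<in>cbox a b. \<forall>z\<in>cbox a b. dist z y < d \<longrightarrow> dist (\<psi> z * f z) (\<psi> y * f y) < \<epsilon>"
        using uc unfolding uniformly_continuous_on_def by blast
      then show "\<exists>\<delta>>0. \<forall>x::real^'n. \<forall>y\<in>cbox a b. \<forall>z\<in>cbox a b. dist y z < \<delta> \<longrightarrow> norm (\<psi> y * f y - \<psi> z * f z) \<le> \<epsilon>"
        by (intro exI[of _ d]) (auto simp: dist_norm less_imp_le)
    qed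
    then show "eventually (\<lambda>n. dist (T (r n)) (integral (cbox a b) (\<lambda>y. \<psi> y * f y)) < \<epsilon>) sequentially"
      by (simp add: Tr dist_norm)
  qed
  moreover have "(\<lambda>n. T (r n)) \<longlonglongrightarrow> T (convolution \<phi> \<psi>)"
  proof (rule distribution_tendsto[OF T r, of _ "R + S"])
    show "convolution \<phi> \<psi> x = 0" if "norm x > R + S" for x
      using R(2) S(2) that by (rule convolution_support)
    then show "test_fn (convolution \<phi> \<psi>)" by (intro test_fnI[of _ "R + S"] smooth_fn_convolution sm \<psi>)
    show "r n x = 0" if "norm x > R + S" for n x
    proof -
      have "\<psi> y * \<phi> (x - y) = 0" for y
        using R(2)[of "x - y"] S(2)[of y] that norm_triangle_ineq2[of x y]
        by (cases "norm y > S") auto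
      then show ?thesis by (auto simp: r_def c_def split_def intro!: sum.neutral)
    qed
    fix js and \<epsilon> :: real assume "\<epsilon> > 0"
    \<comment> \<open>Differentiating \<open>r n\<close> gives the Riemann sum in which
      \<open>\<phi>\<close> is replaced by its derivative \<open>\<Phi>\<close>, and the convolution
      behaves in the same way.\<close>
    define \<Phi> where "\<Phi> = pderivs js \<phi>"
    have c\<Phi>: "continuous_on UNIV \<Phi>" unfolding \<Phi>_def using sm by (intro smooth_fn_continuous smooth_fn_pderivs)
    have s\<Phi>: "\<Phi> x = 0" if "norm x > R" for x
      unfolding \<Phi>_def using R(2) that by (rule pderivs_support)
    obtain M where M: "M > 0" "\<And>x. norm (\<psi> x) \<le> M"
      using continuous_compact_support_bounded[OF c\<psi> S(2)] by blast
    obtain N where N: "N > 0" "\<And>x. norm (\<Phi> x) \<le> N"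
      using continuous_compact_support_bounded[OF c\<Phi> s\<Phi>] by blast
    have "eventually (\<lambda>n. \<forall>x. norm ((\<Sum>(y, K)\<in>p n. of_real (measure lborel K) * (\<psi> y * \<Phi> (x - y)))
        - integral (cbox a b) (\<lambda>y. \<psi> y * \<Phi> (x - y))) < \<epsilon>) sequentially"
    proof (rule riemann[of "\<lambda>x y. \<psi> y * \<Phi> (x - y)", OF _ \<open>\<epsilon> > 0\<close>])
      show "continuous_on (cbox a b) (\<lambda>y. \<psi> y * \<Phi> (x - y))" for x
        using continuous_translate_integrand[OF c\<Phi> c\<psi>] by (rule continuous_on_subset) auto
      fix \<epsilon> :: real assume "\<epsilon> > 0"
      \<comment> \<open>The oscillation of the product is split into two halves, with
        \<open>M\<close> bounding \<open>\<psi>\<close> and \<open>N\<close> bounding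
        \<open>\<Phi>\<close>.\<close>
      have e1: "\<epsilon> / (2 * M) > 0" and e2: "\<epsilon> / (2 * N) > 0" using \<open>\<epsilon> > 0\<close> M(1) N(1) by auto
      obtain d1 where d1: "d1 > 0" "\<And>x y. dist x y < d1 \<Longrightarrow> norm (\<Phi> x - \<Phi> y) < \<epsilon> / (2 * M)"
        using continuous_compact_support_uniform[OF c\<Phi> s\<Phi> e1] by blast
      obtain d2 where d2: "d2 > 0" "\<And>x y. dist x y < d2 \<Longrightarrow> norm (\<psi> x - \<psi> y) < \<epsilon> / (2 * N)"
        using continuous_compact_support_uniform[OF c\<psi> S(2) e2] by blast
      have "norm (\<psi> y * \<Phi> (x - y) - \<psi> z * \<Phi> (x - z)) \<le> \<epsilon>" if yz: "dist y z < min d1 d2" for x y z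
      proof -
        have "\<psi> y * \<Phi> (x - y) - \<psi> z * \<Phi> (x - z) = \<psi> y * (\<Phi> (x - y) - \<Phi> (x - z)) + (\<psi> y - \<psi> z) * \<Phi> (x - z)"
          by (simp add: algebra_simps)
        then have "norm (\<psi> y * \<Phi> (x - y) - \<psi> z * \<Phi> (x - z))
            \<le> norm (\<psi> y) * norm (\<Phi> (x - y) - \<Phi> (x - z)) + norm (\<psi> y - \<psi> z) * norm (\<Phi> (x - z))"
          by (metis norm_mult norm_triangle_ineq)
        also have "\<dots> \<le> M * (\<epsilon> / (2 * M)) + (\<epsilon> / (2 * N)) * N"
        proof (intro add_mono mult_mono M N)
          have "dist (x - y) (x - z) < d1" using yz by (simp add: dist_norm norm_minus_commute)
          then show "norm (\<Phi> (x - y) - \<Phi> (x - z)) \<le> \<epsilon> / (2 * M)" using d1(2) by (simp add: less_imp_le)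
          show "norm (\<psi> y - \<psi> z) \<le> \<epsilon> / (2 * N)" using d2(2)[of y z] yz by simp
        qed (use M N \<open>\<epsilon> > 0\<close> in auto)
        also have "\<dots> = \<epsilon>" using M N by simp
        finally show ?thesis .
      qed
      then show "\<exists>\<delta>>0. \<forall>x. \<forall>y\<in>cbox a b. \<forall>z\<in>cbox a b. dist y z < \<delta> \<longrightarrow> norm (\<psi> y * \<Phi> (x - y) - \<psi> z * \<Phi> (x - z)) \<le> \<epsilon>"
        using d1(1) d2(1) by (intro exI[of _ "min d1 d2"]) auto
    qed
    moreover have "pderivs js (r n) x = (\<Sum>(y, K)\<in>p n. of_real (measure lborel K) * (\<psi> y * \<Phi> (x - y)))" for n x
    proof -
      have "pderivs js (r n) = (\<lambda>x. \<Sum>k\<in>p n. c k * pderivs js (\<lambda>x. \<phi> (x - fst k)) x)"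
        unfolding r_def by (intro pderivs_lincomb smooth_fn_translate sm)
      then show ?thesis
        by (auto simp: pderivs_translate[OF sm] \<Phi>_def c_def split_def mult.assoc)
    qed
    moreover have "pderivs js (convolution \<phi> \<psi>) x = integral (cbox a b) (\<lambda>y. \<psi> y * \<Phi> (x - y))" for x
      unfolding pderivs_convolution[OF sm \<psi>] \<Phi>_def[symmetric]
      by (rule convolution_cbox[OF c\<Phi> c\<psi>]) (rule ab)
    ultimately show "eventually (\<lambda>n. \<forall>x. norm (pderivs js (r n) x - pderivs js (convolution \<phi> \<psi>) x) < \<epsilon>) sequentially"
      by simp
  qed
  ultimately have "T (convolution \<phi> \<psi>) = integral (cbox a b) (\<lambda>y. \<psi> y * f y)"
    using LIMSEQ_unique by blast
  also have "\<dots> = integral\<^sup>L lborel (\<lambda>y. \<psi> y * f y)"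
    using compact_support_lborel_integral(2)[OF cpf, of a b] ab by (auto intro: integral_unique)
  finally show ?thesis by (simp add: f_def)
qed

section \<open>Distributions with finite-dimensional orbit\<close>

text \<open>
  Functionals are total functions, so those coming from distributions are extended by \<open>0\<close> to arguments
  that are not test functions; translation preserves the set of test functions, so orbits are unaffected.
\<close>

definition function_functional :: "((real^'n) \<Rightarrow> complex) \<Rightarrow> ((real^'n) \<Rightarrow> complex) \<Rightarrow> complex" where
  "function_functional e \<phi> = (if test_fn \<phi> then integral\<^sup>L lborel (\<lambda>x. e x * \<phi> x) else 0)"

text \<open>The minus sign makes this dual to translating functions: the functional induced by
  \<open>e\<close> has at \<open>shift y \<phi>\<close> the value that the functional induced by the
  translate of \<open>e\<close> by \<open>y\<close> has at \<open>\<phi>\<close>.\<close>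

definition shift :: "(real^'n) \<Rightarrow> ((real^'n) \<Rightarrow> complex) \<Rightarrow> (real^'n) \<Rightarrow> complex" where
  "shift y \<phi> = (\<lambda>x. \<phi> (x - y))"

lemma shift_0: "shift 0 \<phi> = \<phi>"
  by (simp add: shift_def)

lemma shift_add: "shift (y + z) \<phi> = shift y (shift z \<phi>)"
  by (simp add: shift_def diff_diff_eq)

lemma test_fn_shift [simp]: "test_fn (shift y \<phi>) \<longleftrightarrow> test_fn \<phi>"
proof
  assume "test_fn (shift y \<phi>)"
  from test_fn_translate[OF this, of "- y"] show "test_fn \<phi>" by (simp add: shift_def)
qed (auto simp: shift_def intro: test_fn_translate)

lemma function_functional_lincomb:
  assumes "\<And>i. i \<in> I \<Longrightarrow> continuous_on UNIV (g i)"
  shows "function_functional (\<lambda>x. \<Sum>i\<in>I. c i * g i x) \<phi> = (\<Sum>i\<in>I. c i * function_functional (g i) \<phi>)"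
proof (cases "test_fn \<phi>")
  case True
  have "integral\<^sup>L lborel (\<lambda>x. \<Sum>i\<in>I. c i * (g i x * \<phi> x)) = (\<Sum>i\<in>I. c i * integral\<^sup>L lborel (\<lambda>x. g i x * \<phi> x))"
    using integrable_mult_test_fn[OF assms True]
    by (subst Bochner_Integration.integral_sum) auto
  then show ?thesis using True by (simp add: function_functional_def sum_distrib_right mult.assoc)
qed (simp add: function_functional_def)

lemma expo_poly_continuous: "expo_poly e \<Longrightarrow> continuous_on UNIV e"
  by (intro smooth_fn_continuous smooth_fn_expo_poly)

text \<open>A change of variables moves the translation from the test function to \<open>e\<close>,
  whose own orbit is finite-dimensional.\<close>

lemma fin_orbit_function_functional:
  fixes e :: "(real^'n) \<Rightarrow> complex"
  assumes e: "expo_poly e"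
  shows "fin_orbit shift UNIV (function_functional e)"
proof -
  note ce = expo_poly_continuous[OF e]
  obtain B where B: "finite B" "\<And>y. (\<lambda>x. e (x + y)) \<in> fs.span B"
    using fin_orbit_expo_poly[OF e] by (auto simp: fin_orbit_def)
  define U where "U = fs.span (range (\<lambda>y x. e (x + y)))"
  have UB: "U \<subseteq> fs.span B" unfolding U_def using B by (intro fs.span_minimal) auto
  have sub: "fs.subspace U" unfolding U_def by (rule fs.subspace_span)
  \<comment> \<open>Nothing is known about continuity of the members of \<open>B\<close>. The basis
    is taken inside the span of the translates of \<open>e\<close>, so its members are continuous
    and the integral can be split.\<close>
  obtain P G where P: "finite P" "\<And>p. p \<in> P \<Longrightarrow> G p \<in> U"
    and L: "\<And>g x. g \<in> U \<Longrightarrow> g x = (\<Sum>p\<in>P. g p * G p x)"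
    using lagrange_subspace[OF B(1) UB sub] by metis
  have cG: "continuous_on UNIV (G p)" if "p \<in> P" for p
    using translate_span_continuous[OF ce] P(2)[OF that] by (simp add: U_def)
  have eU: "(\<lambda>x. e (x + y)) \<in> U" for y unfolding U_def by (rule fs.span_base) auto
  have "function_functional e (shift y \<phi>) = (\<Sum>p\<in>P. e (p + y) * function_functional (G p) \<phi>)" for y \<phi>
  proof (cases "test_fn \<phi>")
    case True
    have "continuous_on UNIV (\<lambda>x. e x * shift y \<phi> x)"
      using ce test_fn_continuous[of "shift y \<phi>"] True by (intro continuous_intros) auto
    from lborel_integral_translate[OF this, of y]
    have "function_functional e (shift y \<phi>) = function_functional (\<lambda>x. e (x + y)) \<phi>"
      using True by (simp add: function_functional_def) (simp add: shift_def add.commute)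
    also have "(\<lambda>x. e (x + y)) = (\<lambda>x. \<Sum>p\<in>P. e (p + y) * G p x)"
      by (rule ext) (rule L[OF eU])
    also have "function_functional \<dots> \<phi> = (\<Sum>p\<in>P. e (p + y) * function_functional (G p) \<phi>)"
      using cG by (rule function_functional_lincomb)
    finally show ?thesis .
  qed (simp add: function_functional_def)
  moreover have "(\<lambda>\<phi>. \<Sum>p\<in>P. e (p + y) * function_functional (G p) \<phi>)
      \<in> fs.span ((\<lambda>p. function_functional (G p)) ` P)" for y
    by (intro span_lincomb fs.span_base imageI)
  ultimately show ?thesis unfolding fin_orbit_def using P(1)
    by (intro exI[of _ "(\<lambda>p. function_functional (G p)) ` P"]) auto
qed

text \<open>Both sides are the value of \<open>T\<close> at the convolution, which is
  commutative.\<close>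

lemma distribution_orbit_symmetric:
  assumes T: "distribution T" and "test_fn \<phi>" "test_fn \<psi>"
  shows "integral\<^sup>L lborel (\<lambda>y. T (shift y \<phi>) * \<psi> y) = integral\<^sup>L lborel (\<lambda>y. T (shift y \<psi>) * \<phi> y)"
  using distribution_convolution[OF assms] distribution_convolution[OF T assms(3,2)]
    convolution_commute[OF assms(2,3)[THEN test_fn_continuous]]
  by (simp add: shift_def mult.commute)

lemma dist_exp_poly_of_fin_orbit:
  fixes T :: "((real^'n) \<Rightarrow> complex) \<Rightarrow> complex"
  assumes T: "distribution T"
    and fin: "fin_orbit shift UNIV (\<lambda>\<phi>. if test_fn \<phi> then T \<phi> else 0)"
  shows "dist_exp_poly T"
proof -
  define F where "F = (\<lambda>\<phi>. if test_fn \<phi> then T \<phi> else 0)"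
  define f where "f = (\<lambda>\<phi> y. F (shift y \<phi>))"
  have cf: "continuous_on UNIV (f \<phi>)" for \<phi>
    using distribution_translate_continuous[OF T, of \<phi>]
    by (cases "test_fn \<phi>") (auto simp: f_def F_def shift_def[abs_def] test_fn_shift[unfolded shift_def])
  obtain B where B: "finite B" "\<And>y. (\<lambda>\<phi>. F (shift y \<phi>)) \<in> fs.span B"
    using fin by (auto simp: fin_orbit_def F_def)
  have ef: "expo_poly (f \<phi>)" for \<phi>
  proof (rule expo_poly_of_fin_orbit[OF cf])
    \<comment> \<open>The orbit of \<open>f \<phi>\<close> is the pullback of the orbit of
      \<open>F\<close> along the map from \<open>x\<close> to \<open>shift x \<phi>\<close>.\<close>
    have "(\<lambda>x. f \<phi> (x + y)) \<in> fs.span ((\<lambda>b x. b (shift x \<phi>)) ` B)" for y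
    proof -
      have "f \<phi> (x + y) = F (shift y (shift x \<phi>))" for x
        by (simp add: f_def shift_add[symmetric] add.commute)
      then show ?thesis using span_pullback[OF B(2)[of y], of "\<lambda>x. shift x \<phi>"] by simp
    qed
    then show "fin_orbit (\<lambda>y x. x + y) UNIV (f \<phi>)"
      unfolding fin_orbit_def using B(1) by (intro exI[of _ "(\<lambda>b x. b (shift x \<phi>)) ` B"]) auto
  qed
  \<comment> \<open>The case distinction makes it unnecessary to construct a bump function.\<close>
  show ?thesis
  proof (cases "\<exists>\<rho> w. test_fn \<rho> \<and> \<rho> (w::real^'n) \<noteq> 0")
    case False
    have "T \<phi> = 0" if "test_fn \<phi>" for \<phi>
    proof -
      have "\<phi> = (\<lambda>x. \<Sum>k\<in>{}. 0)" using False that by auto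
      then show ?thesis using distribution_lincomb[OF T, of "{}" "\<lambda>_. \<phi>" "\<lambda>_. 0"] by simp
    qed
    then show ?thesis unfolding dist_exp_poly_def
      by (intro exI[of _ "\<lambda>x. 0"]) (auto intro: expo_poly_const)
  next
    case True
    then obtain \<rho> w where \<rho>: "test_fn \<rho>" "\<rho> (w::real^'n) \<noteq> 0" by blast
    obtain P G where P: "finite P" and L: "\<And>g x. g \<in> fs.span B \<Longrightarrow> g x = (\<Sum>p\<in>P. g p * G p x)"
      using lagrange_subspace[OF B(1) order_refl fs.subspace_span] by metis
    \<comment> \<open>The nodes \<open>p\<close> are functions on the Euclidean space here. All
      \<open>f \<phi>\<close> thus lie in the span of the finitely many \<open>f p\<close>.\<close>
    have f_eq: "f \<phi> y = (\<Sum>p\<in>P. G p \<phi> * f p y)" for \<phi> y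
      using L[OF B(2), of y \<phi>] by (simp add: f_def mult.commute)
    define U where "U = fs.span ((\<lambda>p. function_functional (f p)) ` P)"
    obtain Q H where Q: "finite Q" "\<And>q. q \<in> Q \<Longrightarrow> H q \<in> U"
      and M: "\<And>g \<psi>. g \<in> U \<Longrightarrow> g \<psi> = (\<Sum>q\<in>Q. g q * H q \<psi>)"
      using lagrange_subspace[of "(\<lambda>p. function_functional (f p)) ` P" U] P fs.subspace_span
      unfolding U_def by blast
    have "\<exists>l. expo_poly l \<and> g = function_functional l" if "g \<in> U" for g
    proof -
      obtain c where c: "g = (\<lambda>\<phi>. \<Sum>b\<in>(\<lambda>p. function_functional (f p)) ` P. c b * b \<phi>)"
        using span_finite_lincomb[of "(\<lambda>p. function_functional (f p)) ` P" g] P \<open>g \<in> U\<close>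
        unfolding U_def by blast
      \<comment> \<open>Different nodes may induce the same functional. The sum runs over distinct
        functionals, and \<open>s\<close> picks one representative for each.\<close>
      have "\<forall>b\<in>(\<lambda>p. function_functional (f p)) ` P. \<exists>p. b = function_functional (f p)" by blast
      then obtain s where s: "\<And>b. b \<in> (\<lambda>p. function_functional (f p)) ` P \<Longrightarrow> b = function_functional (f (s b))"
        by metis
      define l where "l = (\<lambda>x. \<Sum>b\<in>(\<lambda>p. function_functional (f p)) ` P. c b * f (s b) x)"
      have "g = function_functional l"
      proof
        fix \<phi>
        have "g \<phi> = (\<Sum>b\<in>(\<lambda>p. function_functional (f p)) ` P. c b * function_functional (f (s b)) \<phi>)"
          unfolding c by (intro sum.cong refl arg_cong2[of _ _ _ _ "(*)"] fun_cong[OF s])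
        also have "\<dots> = function_functional l \<phi>"
          unfolding l_def by (rule function_functional_lincomb[symmetric]) (rule cf)
        finally show "g \<phi> = function_functional l \<phi>" .
      qed
      moreover have "expo_poly l" unfolding l_def by (intro expo_poly_lincomb ef)
      ultimately show ?thesis by blast
    qed
    then have "\<forall>q\<in>Q. \<exists>l. expo_poly l \<and> H q = function_functional l" using Q(2) by blast
    from bchoice[OF this] obtain l where "\<forall>q\<in>Q. expo_poly (l q) \<and> H q = function_functional (l q)" ..
    then have l: "\<And>q. q \<in> Q \<Longrightarrow> expo_poly (l q)" "\<And>q. q \<in> Q \<Longrightarrow> H q = function_functional (l q)"
      by blast+
    \<comment> \<open>The aim is the pointwise identity of \<open>f \<phi>\<close> with the sum of
      the \<open>l q\<close>, weighted by the integrals of \<open>f q\<close> against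
      \<open>\<phi>\<close>. At 0 its left side is \<open>T \<phi>\<close>, and its right side is
      the integral of this \<open>e\<close> against \<open>\<phi>\<close>.\<close>
    define e where "e = (\<lambda>x. \<Sum>q\<in>Q. l q 0 * f q x)"
    have "T \<phi> = integral\<^sup>L lborel (\<lambda>x. e x * \<phi> x)" if \<phi>: "test_fn \<phi>" for \<phi>
    proof -
      \<comment> \<open>The expansion coefficient at the node \<open>q\<close> becomes an integral
        against \<open>\<phi>\<close>. If \<open>q\<close> is not a test function, both sides are
        0.\<close>
      have sym: "function_functional (f \<phi>) q = function_functional (f q) \<phi>" for q
      proof (cases "test_fn q")
        case True
        then show ?thesis using distribution_orbit_symmetric[OF T \<phi> True] \<phi>
          by (simp add: function_functional_def f_def F_def)
      qed (simp add: function_functional_def f_def F_def)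
      have fe: "f \<phi> = (\<lambda>y. \<Sum>p\<in>P. G p \<phi> * f p y)" by (rule ext) (rule f_eq)
      have "function_functional (f \<phi>) = (\<lambda>\<psi>. \<Sum>p\<in>P. G p \<phi> * function_functional (f p) \<psi>)"
        by (rule ext, subst fe, rule function_functional_lincomb) (rule cf)
      also have "\<dots> \<in> U" unfolding U_def by (intro span_lincomb fs.span_base imageI)
      finally have fU: "function_functional (f \<phi>) \<in> U" .
      \<comment> \<open>Both terms of \<open>d\<close> induce the same functional, so
        \<open>d\<close> vanishes identically; the value at 0 is what is needed.\<close>
      define d where "d = (\<lambda>x. 1 * f \<phi> x + (-1) * (\<Sum>q\<in>Q. function_functional (f q) \<phi> * l q x))"
      have "d 0 = 0"
      proof (rule smooth_fn_zero_of_test_integrals[OF _ \<rho>])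
        show "smooth_fn d" unfolding d_def
          by (intro smooth_fn_expo_poly expo_poly_add expo_poly_mult expo_poly_const ef expo_poly_lincomb l)
        fix \<psi> :: "(real^'n) \<Rightarrow> complex" assume \<psi>: "test_fn \<psi>"
        have "function_functional (f \<phi>) \<psi> = (\<Sum>q\<in>Q. function_functional (f q) \<phi> * function_functional (l q) \<psi>)"
          using M[OF fU, of \<psi>] l(2) by (simp add: sym)
        also have "\<dots> = function_functional (\<lambda>x. \<Sum>q\<in>Q. function_functional (f q) \<phi> * l q x) \<psi>"
          using l(1) by (intro function_functional_lincomb[symmetric] expo_poly_continuous)
        finally have eq: "integral\<^sup>L lborel (\<lambda>x. f \<phi> x * \<psi> x)
            = integral\<^sup>L lborel (\<lambda>x. (\<Sum>q\<in>Q. function_functional (f q) \<phi> * l q x) * \<psi> x)"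
          using \<psi> by (simp add: function_functional_def[of _ \<psi>])
        have "integral\<^sup>L lborel (\<lambda>x. d x * \<psi> x) = integral\<^sup>L lborel (\<lambda>x. f \<phi> x * \<psi> x
            - (\<Sum>q\<in>Q. function_functional (f q) \<phi> * l q x) * \<psi> x)"
          by (simp add: d_def algebra_simps)
        also have "\<dots> = 0"
          using \<psi> l(1) eq
          by (subst Bochner_Integration.integral_diff)
             (auto intro!: integrable_mult_test_fn cf expo_poly_continuous expo_poly_lincomb)
        finally show "integral\<^sup>L lborel (\<lambda>x. d x * \<psi> x) = 0" .
      qed
      then have "T \<phi> = (\<Sum>q\<in>Q. l q 0 * function_functional (f q) \<phi>)"
        using \<phi> by (simp add: d_def f_def F_def shift_0 mult.commute)
      also have "\<dots> = function_functional e \<phi>"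
        unfolding e_def by (rule function_functional_lincomb[symmetric]) (rule cf)
      finally show ?thesis using \<phi> by (simp add: function_functional_def)
    qed
    moreover have "expo_poly e" unfolding e_def by (intro expo_poly_lincomb ef)
    ultimately show ?thesis unfolding dist_exp_poly_def by blast
  qed
qed

lemma dist_exp_poly_of_differences:
  fixes T :: "((real^'n) \<Rightarrow> complex) \<Rightarrow> complex"
  assumes "dense_subgroup t h" and T: "distribution T"
    and E: "\<And>k. k \<in> {1..t} \<Longrightarrow> dist_exp_poly (dist_fdiff (h k) (m k) T)"
  shows "dist_exp_poly T"
proof (rule dist_exp_poly_of_fin_orbit[OF T])
  define F where "F = (\<lambda>\<phi>. if test_fn \<phi> then T \<phi> else 0)"
  have "fin_orbit shift UNIV F"
  proof (rule fin_orbit_differences[where t = t and h = h and m = m])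
    show "closure {(\<Sum>k\<in>{1..t}. real_of_int (n k) *\<^sub>R h k) | n :: nat \<Rightarrow> int. True} = UNIV"
      using assms(1) by (simp add: dense_subgroup_def)
    show "continuous_on UNIV (\<lambda>y. F (shift y \<phi>))" for \<phi>
      using distribution_translate_continuous[OF T, of \<phi>]
      by (cases "test_fn \<phi>") (auto simp: F_def shift_def test_fn_shift[unfolded shift_def])
    fix k assume k: "k \<in> {1..t}"
    obtain e where e: "expo_poly e" "\<And>\<phi>. test_fn \<phi> \<Longrightarrow> dist_fdiff (h k) (m k) T \<phi> = integral\<^sup>L lborel (\<lambda>x. e x * \<phi> x)"
      using E[OF k] unfolding dist_exp_poly_def by blast
    have "(\<Sum>j\<le>m k. of_nat (m k choose j) * (-1) ^ (m k - j) * F (shift (real j *\<^sub>R h k) \<phi>)) = function_functional e \<phi>" for \<phi>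
    proof (cases "test_fn \<phi>")
      case True
      \<comment> \<open>The step \<open>- h k\<close> on test functions is \<open>shift\<close> by
        positive multiples of \<open>h k\<close>, so linearity of \<open>T\<close> turns the
        distributional difference into a difference along the orbit of \<open>F\<close>.\<close>
      have "fdiff (- h k) (m k) \<phi> = (\<lambda>x. \<Sum>j\<le>m k. of_nat (m k choose j) * (-1) ^ (m k - j) * shift (real j *\<^sub>R h k) \<phi> x)"
        by (auto simp: fdiff_def shift_def)
      then have "dist_fdiff (h k) (m k) T \<phi> = (\<Sum>j\<le>m k. of_nat (m k choose j) * (-1) ^ (m k - j) * T (shift (real j *\<^sub>R h k) \<phi>))"
        using True by (simp only: dist_fdiff_def) (intro distribution_lincomb T, auto)
      then show ?thesis using True e(2)[OF True] by (simp add: F_def function_functional_def)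
    qed (simp add: F_def function_functional_def)
    then show "fin_orbit shift UNIV (\<lambda>\<phi>. \<Sum>j\<le>m k. of_nat (m k choose j) * (-1) ^ (m k - j) * F (shift (real j *\<^sub>R h k) \<phi>))"
      using fin_orbit_function_functional[OF e(1)] by simp
  qed (auto simp: shift_0 shift_add)
  then show "fin_orbit shift UNIV (\<lambda>\<phi>. if test_fn \<phi> then T \<phi> else 0)" by (simp add: F_def)
qed

theorem theorem4:
  fixes t :: nat and h :: "nat \<Rightarrow> (real^'n)" and m :: "nat \<Rightarrow> nat"
  assumes "dense_subgroup t h"
  shows "(\<forall>f :: (real^'n) \<Rightarrow> complex. continuous_on UNIV f \<longrightarrow>
            (\<forall>k\<in>{1..t}. expo_poly (fdiff (h k) (m k) f)) \<longrightarrow> expo_poly f)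
       \<and> (\<forall>T :: ((real^'n) \<Rightarrow> complex) \<Rightarrow> complex. distribution T \<longrightarrow>
            (\<forall>k\<in>{1..t}. dist_exp_poly (dist_fdiff (h k) (m k) T)) \<longrightarrow> dist_exp_poly T)"
  using expo_poly_of_differences[OF assms] dist_exp_poly_of_differences[OF assms] by blast

end
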